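(* Let $\mathcal{M}\neq\{0\}$ be a closed subspace of $\mathcal{H}^2(\mathbb{T}^2)$ invariant under $T_w$ and $T_z$. The pair $(T_w|_{\mathcal{M}},T_z|_{\mathcal{M}})$ is compatible if and only if $\mathcal{M}=\phi\,\mathcal{M}_J$ for some inner function $\phi$ and some diagram $J\subset\mathbb{Z}_+^2$, where $\mathcal{M}_J$ is the closed linear span of $\{w^iz^j:(i,j)\in J\}$.
   Context: $\mathbb{T}$ is the unit circle, $\mathbb{T}^2$ the torus with normalized Lebesgue measure and variables $(w,z)$, and $\mathbb{Z}_+=\{0,1,2,\dots\}$. $\mathcal{H}^2(\mathbb{T}^2)\subset L^2(\mathbb{T}^2)$ is the Hardy space, i.e. the closed span of $\{w^iz^j:i,j\in\mathbb{Z}_+\}$. $T_w,T_z$ are the operators of multiplication by $w$ and by $z$ on $\mathcal{H}^2(\mathbb{T}^2)$. A function $\phi\in\mathcal{H}^\infty(\mathbb{T}^2)$ (bounded functions in $\mathcal{H}^2(\mathbb{T}^2)$) is inner if $|\phi|=1$ almost everywhere on $\mathbb{T}^2$. A set $J\subset\mathbb{Z}^2$ is a diagram if $J+\mathbb{Z}_+^2\subset J$ (coordinatewise addition). A pair of commuting isometries $V_1,V_2$ on a Hilbert space is compatible if the orthogonal projections $P_{\mathrm{ran}(V_1^m)}$ and $P_{\mathrm{ran}(V_2^n)}$ commute for all $m,n\in\mathbb{Z}_+$. *)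

theory Defs
  imports "HOL-Probability.Probability"
begin

section \<open>The torus and its normalized Lebesgue measure\<close>

definition circle :: "complex measure" where
  "circle = distr (uniform_measure lborel {0..2 * pi}) (restrict_space borel (sphere 0 1)) cis"

definition torus :: "(complex \<times> complex) measure" where
  "torus = circle \<Otimes>\<^sub>M circle"

lemma prob_space_circle: "prob_space circle"
  unfolding circle_def
proof (rule prob_space.prob_space_distr)
  show "prob_space (uniform_measure lborel {0..2 * pi})"
    by (rule prob_space_uniform_measure) auto
  have "cis \<in> borel_measurable borel"
    by (intro borel_measurable_continuous_onI continuous_intros)
  then show "cis \<in> uniform_measure lborel {0..2 * pi} \<rightarrow>\<^sub>M restrict_space borel (sphere 0 1)"
    by (intro measurable_restrict_space2) auto
qed

lemma prob_space_torus: "prob_space torus"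
proof -
  interpret C: prob_space circle by (rule prob_space_circle)
  interpret CC: pair_prob_space circle circle by unfold_locales
  show ?thesis unfolding torus_def by (rule CC.prob_space_axioms)
qed

lemma space_torus: "space torus = sphere 0 1 \<times> sphere 0 1"
  by (auto simp: torus_def circle_def space_pair_measure space_restrict_space)


section \<open>The Hilbert space of square-integrable functions modulo null sets\<close>

definition square_integrable :: "(complex \<times> complex \<Rightarrow> complex) \<Rightarrow> bool" where
  "square_integrable f \<longleftrightarrow>
     f \<in> borel_measurable torus \<and> integrable torus (\<lambda>x. (cmod (f x))\<^sup>2)"

definition L2_eq :: "(complex \<times> complex \<Rightarrow> complex) \<Rightarrow> (complex \<times> complex \<Rightarrow> complex) \<Rightarrow> bool"
  where "L2_eq f g \<longleftrightarrow>
     square_integrable f \<and> square_integrable g \<and> (AE x in torus. f x = g x)"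

lemma square_integrable_measurable [measurable_dest]:
  "square_integrable f \<Longrightarrow> f \<in> borel_measurable torus"
  by (simp add: square_integrable_def)

lemma square_integrable_zero: "square_integrable (\<lambda>_. 0)"
  by (simp add: square_integrable_def)

lemma square_integrable_scale:
  "square_integrable f \<Longrightarrow> square_integrable (\<lambda>x. c * f x)"
  by (auto simp: square_integrable_def norm_mult power_mult_distrib)

lemma square_integrable_add:
  assumes f: "square_integrable f" and g: "square_integrable g"
  shows "square_integrable (\<lambda>x. f x + g x)"
proof -
  note [measurable] = f[THEN square_integrable_measurable] g[THEN square_integrable_measurable]
  have "integrable torus (\<lambda>x. (cmod (f x + g x))\<^sup>2)"
  proof (rule Bochner_Integration.integrable_bound)
    show "integrable torus (\<lambda>x. 2 * (cmod (f x))\<^sup>2 + 2 * (cmod (g x))\<^sup>2)"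
      using f g by (simp add: square_integrable_def)
    have "(cmod (a + b))\<^sup>2 \<le> 2 * (cmod a)\<^sup>2 + 2 * (cmod b)\<^sup>2" for a b :: complex
    proof -
      have "(cmod (a + b))\<^sup>2 \<le> (cmod a + cmod b)\<^sup>2"
        by (intro power_mono norm_triangle_ineq) auto
      also have "\<dots> \<le> 2 * (cmod a)\<^sup>2 + 2 * (cmod b)\<^sup>2"
        using sum_squares_bound[of "cmod a" "cmod b"] by (simp add: power2_sum)
      finally show ?thesis .
    qed
    then show "AE x in torus. norm ((cmod (f x + g x))\<^sup>2)
        \<le> norm (2 * (cmod (f x))\<^sup>2 + 2 * (cmod (g x))\<^sup>2)"
      by (intro AE_I2) simp
  qed measurable
  then show ?thesis by (simp add: square_integrable_def)
qed

lemma borel_measurable_cnj [measurable (raw)]: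
  "f \<in> borel_measurable M \<Longrightarrow> (\<lambda>x. cnj (f x)) \<in> borel_measurable M"
  by (rule measurable_compose[OF _ borel_measurable_continuous_onI]) (auto intro: continuous_intros)

lemma integrable_mult_cnj:
  assumes f: "square_integrable f" and g: "square_integrable g"
  shows "integrable torus (\<lambda>x. f x * cnj (g x))"
proof (rule Bochner_Integration.integrable_bound)
  note [measurable] = f[THEN square_integrable_measurable] g[THEN square_integrable_measurable]
  show "integrable torus (\<lambda>x. (cmod (f x))\<^sup>2 + (cmod (g x))\<^sup>2)"
    using f g by (simp add: square_integrable_def)
  show "(\<lambda>x. f x * cnj (g x)) \<in> borel_measurable torus" by measurable
  have "cmod a * cmod b \<le> (cmod a)\<^sup>2 + (cmod b)\<^sup>2" for a b :: complex
    using sum_squares_bound[of "cmod a" "cmod b"]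
      mult_nonneg_nonneg[OF norm_ge_zero[of a] norm_ge_zero[of b]] by linarith
  then show "AE x in torus. norm (f x * cnj (g x)) \<le> norm ((cmod (f x))\<^sup>2 + (cmod (g x))\<^sup>2)"
    by (intro AE_I2) (simp add: norm_mult)
qed

quotient_type L2_torus = "complex \<times> complex \<Rightarrow> complex" / partial: L2_eq
proof (rule part_equivpI)
  show "\<exists>f. L2_eq f f"
    by (rule exI[of _ "\<lambda>_. 0"]) (simp add: L2_eq_def square_integrable_zero)
  show "symp L2_eq" by (rule sympI) (auto simp: L2_eq_def)
  show "transp L2_eq" by (rule transpI) (auto simp: L2_eq_def)
qed

lemma L2_eq_rep: "L2_eq (rep_L2_torus u) (rep_L2_torus u)"
  using Quotient3_rep_reflp[OF Quotient3_L2_torus] .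

lemma rep_abs_L2:
  "square_integrable f \<Longrightarrow> AE x in torus. rep_L2_torus (abs_L2_torus f) x = f x"
  using rep_abs_rsp[OF Quotient3_L2_torus, of f f] by (auto simp: L2_eq_def)

instantiation L2_torus :: ab_group_add
begin

lift_definition zero_L2_torus :: L2_torus is "\<lambda>_. 0"
  by (simp add: L2_eq_def square_integrable_zero)

lift_definition plus_L2_torus :: "L2_torus \<Rightarrow> L2_torus \<Rightarrow> L2_torus" is "\<lambda>f g x. f x + g x"
  by (auto simp: L2_eq_def square_integrable_add)

lift_definition uminus_L2_torus :: "L2_torus \<Rightarrow> L2_torus" is "\<lambda>f x. - f x"
  using square_integrable_scale[of _ "-1"] by (auto simp: L2_eq_def)

definition minus_L2_torus :: "L2_torus \<Rightarrow> L2_torus \<Rightarrow> L2_torus" where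
  "minus_L2_torus u v = u + - v"

instance
proof
  fix a b c :: L2_torus
  show "a + b + c = a + (b + c)"
    by transfer (auto simp: L2_eq_def add.assoc square_integrable_add)
  show "a + b = b + a"
    by transfer (auto simp: L2_eq_def add.commute square_integrable_add)
  show "0 + a = a"
    by transfer (auto simp: L2_eq_def)
  show "- a + a = 0"
    by transfer (auto simp: L2_eq_def square_integrable_zero)
  show "a - b = a + - b"
    by (rule minus_L2_torus_def)
qed

end

lift_definition scaleC :: "complex \<Rightarrow> L2_torus \<Rightarrow> L2_torus" (infixr "*\<^sub>C" 75)
  is "\<lambda>c f x. c * f x"
  by (auto simp: L2_eq_def square_integrable_scale)

text \<open>Complex linear subspaces and spans are \<open>L2.subspace\<close> and \<open>L2.span\<close>.\<close>

global_interpretation L2: vector_space scaleC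
proof
  fix a b :: complex and x y :: L2_torus
  show "a *\<^sub>C (x + y) = a *\<^sub>C x + a *\<^sub>C y"
    by transfer (auto simp: L2_eq_def distrib_left square_integrable_add square_integrable_scale)
  show "(a + b) *\<^sub>C x = a *\<^sub>C x + b *\<^sub>C x"
    by transfer (auto simp: L2_eq_def distrib_right square_integrable_add square_integrable_scale
        simp flip: distrib_right)
  show "a *\<^sub>C b *\<^sub>C x = (a * b) *\<^sub>C x"
    by transfer (auto simp: L2_eq_def mult.assoc square_integrable_scale)
  show "1 *\<^sub>C x = x"
    by transfer (auto simp: L2_eq_def)
qed

lift_definition cinner :: "L2_torus \<Rightarrow> L2_torus \<Rightarrow> complex"
  is "\<lambda>f g. \<integral>x. f x * cnj (g x) \<partial>torus"
  by (rule integral_cong_AE)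
    (auto simp: L2_eq_def intro!: borel_measurable_times borel_measurable_cnj
      dest: square_integrable_measurable)

lemma cinner_add_left: "cinner (u + v) w = cinner u w + cinner v w"
  by transfer (auto simp: L2_eq_def distrib_right integrable_mult_cnj)

lemma cinner_scaleC_left: "cinner (c *\<^sub>C u) v = c * cinner u v"
  by transfer (auto simp: L2_eq_def mult.assoc)

lemma cinner_commute: "cinner u v = cnj (cinner v u)"
  unfolding cinner.rep_eq by (subst Bochner_Integration.integral_cnj[symmetric]) (simp add: mult.commute)

lemma cinner_self: "cinner u u = of_real (\<integral>x. (cmod (rep_L2_torus u x))\<^sup>2 \<partial>torus)"
  unfolding cinner.rep_eq
  by (simp add: integral_complex_of_real[symmetric] complex_norm_square del: of_real_power)

lemma cinner_self_eq_0: "Re (cinner u u) = 0 \<longleftrightarrow> u = 0"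
proof -
  have "(\<integral>x. (cmod (f x))\<^sup>2 \<partial>torus) = 0 \<longleftrightarrow> (AE x in torus. f x = 0)"
    if "square_integrable f" for f
    using that by (subst integral_nonneg_eq_0_iff_AE) (auto simp: square_integrable_def)
  then have *: "(\<integral>x. (cmod (rep_L2_torus u x))\<^sup>2 \<partial>torus) = 0 \<longleftrightarrow> L2_eq (rep_L2_torus u) (\<lambda>_. 0)"
    using L2_eq_rep[of u] by (auto simp: L2_eq_def square_integrable_zero)
  have "L2_eq (rep_L2_torus u) (\<lambda>_. 0) \<longleftrightarrow> u = 0"
    using Quotient3_rel[OF Quotient3_L2_torus, of "rep_L2_torus u" "\<lambda>_. 0"] L2_eq_rep[of u]
    by (auto simp: Quotient3_abs_rep[OF Quotient3_L2_torus] zero_L2_torus.abs_eq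
        L2_eq_def square_integrable_zero)
  with * show ?thesis by (simp add: cinner_self)
qed

instantiation L2_torus :: real_inner
begin

definition scaleR_L2_torus :: "real \<Rightarrow> L2_torus \<Rightarrow> L2_torus" where
  "scaleR_L2_torus r u = complex_of_real r *\<^sub>C u"

definition inner_L2_torus :: "L2_torus \<Rightarrow> L2_torus \<Rightarrow> real" where
  "inner_L2_torus u v = Re (cinner u v)"

definition norm_L2_torus :: "L2_torus \<Rightarrow> real" where
  "norm_L2_torus u = sqrt (inner u u)"

definition dist_L2_torus :: "L2_torus \<Rightarrow> L2_torus \<Rightarrow> real" where
  "dist_L2_torus u v = norm (u - v)"

definition sgn_L2_torus :: "L2_torus \<Rightarrow> L2_torus" where
  "sgn_L2_torus u = inverse (norm u) *\<^sub>R u"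

definition uniformity_L2_torus :: "(L2_torus \<times> L2_torus) filter" where
  "uniformity_L2_torus = (INF e\<in>{0 <..}. principal {(x, y). dist x y < e})"

definition open_L2_torus :: "L2_torus set \<Rightarrow> bool" where
  "open_L2_torus U \<longleftrightarrow> (\<forall>x\<in>U. eventually (\<lambda>(x', y). x' = x \<longrightarrow> y \<in> U) uniformity)"

instance
proof
  fix a b :: real and x y z :: L2_torus
  show "a *\<^sub>R (x + y) = a *\<^sub>R x + a *\<^sub>R y"
    by (simp add: scaleR_L2_torus_def L2.scale_right_distrib)
  show "(a + b) *\<^sub>R x = a *\<^sub>R x + b *\<^sub>R x"
    by (simp add: scaleR_L2_torus_def L2.scale_left_distrib)
  show "a *\<^sub>R b *\<^sub>R x = (a * b) *\<^sub>R x"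
    by (simp add: scaleR_L2_torus_def)
  show "1 *\<^sub>R x = x"
    by (simp add: scaleR_L2_torus_def)
  show "dist x y = norm (x - y)" by (rule dist_L2_torus_def)
  show "sgn x = inverse (norm x) *\<^sub>R x" by (rule sgn_L2_torus_def)
  show "(uniformity :: (L2_torus \<times> L2_torus) filter) = (INF e\<in>{0 <..}. principal {(x, y). dist x y < e})"
    by (rule uniformity_L2_torus_def)
  show "open U = (\<forall>x\<in>U. \<forall>\<^sub>F (x', y) in uniformity. x' = x \<longrightarrow> y \<in> U)" for U :: "L2_torus set"
    by (rule open_L2_torus_def)
  show "inner x y = inner y x"
    unfolding inner_L2_torus_def by (subst cinner_commute) simp
  show "inner (x + y) z = inner x z + inner y z"
    by (simp add: inner_L2_torus_def cinner_add_left)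
  show "inner (a *\<^sub>R x) y = a * inner x y"
    by (simp add: inner_L2_torus_def scaleR_L2_torus_def cinner_scaleC_left)
  show "0 \<le> inner x x"
    by (simp add: inner_L2_torus_def cinner_self)
  show "inner x x = 0 \<longleftrightarrow> x = 0"
    unfolding inner_L2_torus_def by (rule cinner_self_eq_0)
  show "norm x = sqrt (inner x x)" by (rule norm_L2_torus_def)
qed

end


section \<open>Hardy space, multiplication operators, inner functions\<close>

text \<open>
  The pointwise product is square-integrable, and the result thus meaningful, when one factor
  is essentially bounded; only such products occur below.
\<close>
definition L2_mult :: "L2_torus \<Rightarrow> L2_torus \<Rightarrow> L2_torus" where
  "L2_mult u v = abs_L2_torus (\<lambda>x. rep_L2_torus u x * rep_L2_torus v x)"

definition monomial :: "int \<Rightarrow> int \<Rightarrow> L2_torus" where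
  "monomial i j = abs_L2_torus (\<lambda>(w, z). w powi i * z powi j)"

definition closed_span :: "L2_torus set \<Rightarrow> L2_torus set" where
  "closed_span S = closure (L2.span S)"

definition Hardy :: "L2_torus set" where
  "Hardy = closed_span {monomial i j |i j. i \<ge> 0 \<and> j \<ge> 0}"

definition T_w :: "L2_torus \<Rightarrow> L2_torus" where
  "T_w f = L2_mult (monomial 1 0) f"

definition T_z :: "L2_torus \<Rightarrow> L2_torus" where
  "T_z f = L2_mult (monomial 0 1) f"

definition ess_bounded :: "L2_torus \<Rightarrow> bool" where
  "ess_bounded u \<longleftrightarrow> (\<exists>C. AE x in torus. cmod (rep_L2_torus u x) \<le> C)"

definition Hardy_inf :: "L2_torus set" where
  "Hardy_inf = {u \<in> Hardy. ess_bounded u}"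

definition inner_function :: "L2_torus \<Rightarrow> bool" where
  "inner_function u \<longleftrightarrow> u \<in> Hardy_inf \<and> (AE x in torus. cmod (rep_L2_torus u x) = 1)"

lemma rep_monomial:
  "AE x in torus. rep_L2_torus (monomial i j) x = fst x powi i * snd x powi j"
proof -
  interpret prob_space torus by (rule prob_space_torus)
  have [measurable]: "(\<lambda>x. x powi i) \<in> borel_measurable circle" for i
  proof -
    have "(\<lambda>x :: complex. x powi i) \<in> borel_measurable borel"
      by (cases "i \<ge> 0") (auto simp: power_int_def)
    then show ?thesis
      unfolding circle_def by (simp add: measurable_restrict_space1)
  qed
  have [measurable]: "(\<lambda>x. fst x powi i * snd x powi j) \<in> borel_measurable torus"
    unfolding torus_def by measurable
  have "(\<lambda>x. (cmod (fst x powi i * snd x powi j))\<^sup>2) \<in> borel_measurable torus"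
    by measurable
  then have "square_integrable (\<lambda>x. fst x powi i * snd x powi j)"
    unfolding square_integrable_def
    by (intro conjI integrable_const_bound[where B = 1] AE_I2)
      (auto simp: space_torus norm_mult norm_power_int simp del: borel_measurable_power)
  from rep_abs_L2[OF this] show ?thesis
    by (simp add: monomial_def case_prod_unfold)
qed

lemma rep_L2_mult:
  assumes "ess_bounded u"
  shows "AE x in torus. rep_L2_torus (L2_mult u v) x = rep_L2_torus u x * rep_L2_torus v x"
proof -
  define f g where fg: "f = rep_L2_torus u" "g = rep_L2_torus v"
  have f: "square_integrable f" and g: "square_integrable g"
    using L2_eq_rep by (auto simp: fg L2_eq_def)
  note [measurable] = f[THEN square_integrable_measurable] g[THEN square_integrable_measurable]
  obtain C where C: "AE x in torus. cmod (f x) \<le> C"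
    using assms by (auto simp: ess_bounded_def fg)
  have "integrable torus (\<lambda>x. (cmod (f x * g x))\<^sup>2)"
  proof (rule Bochner_Integration.integrable_bound)
    show "integrable torus (\<lambda>x. C\<^sup>2 * (cmod (g x))\<^sup>2)"
      using g by (simp add: square_integrable_def)
    show "AE x in torus. norm ((cmod (f x * g x))\<^sup>2) \<le> norm (C\<^sup>2 * (cmod (g x))\<^sup>2)"
      using C by eventually_elim
        (auto simp: norm_mult power_mult_distrib intro!: mult_right_mono power_mono)
  qed measurable
  then have "square_integrable (\<lambda>x. f x * g x)"
    by (simp add: square_integrable_def)
  from rep_abs_L2[OF this] show ?thesis
    by (simp add: L2_mult_def fg)
qed


section \<open>Diagrams and compatible pairs\<close>

definition diagram :: "(int \<times> int) set \<Rightarrow> bool" where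
  "diagram J \<longleftrightarrow> (\<forall>(i, j)\<in>J. \<forall>m\<ge>0. \<forall>n\<ge>0. (i + m, j + n) \<in> J)"

definition M_diagram :: "(int \<times> int) set \<Rightarrow> L2_torus set" where
  "M_diagram J = closed_span {monomial i j |i j. (i, j) \<in> J}"

text \<open>
  In the following definitions \<open>H\<close> is a closed subspace, regarded as a Hilbert space of its own;
  an operator on \<open>H\<close> is a total function of which only the values on \<open>H\<close> matter.
\<close>

definition orth_proj :: "L2_torus set \<Rightarrow> L2_torus \<Rightarrow> L2_torus" where
  "orth_proj S u = (THE v. v \<in> S \<and> (\<forall>s\<in>S. cinner (u - v) s = 0))"

definition isometry_on :: "L2_torus set \<Rightarrow> (L2_torus \<Rightarrow> L2_torus) \<Rightarrow> bool" where
  "isometry_on H V \<longleftrightarrow> V ` H \<subseteq> H \<and>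
     (\<forall>u\<in>H. \<forall>v\<in>H. V (u + v) = V u + V v) \<and> (\<forall>c. \<forall>u\<in>H. V (c *\<^sub>C u) = c *\<^sub>C V u) \<and>
     (\<forall>u\<in>H. norm (V u) = norm u)"

definition compatible ::
  "L2_torus set \<Rightarrow> (L2_torus \<Rightarrow> L2_torus) \<Rightarrow> (L2_torus \<Rightarrow> L2_torus) \<Rightarrow> bool" where
  "compatible H V1 V2 \<longleftrightarrow>
     isometry_on H V1 \<and> isometry_on H V2 \<and> (\<forall>u\<in>H. V1 (V2 u) = V2 (V1 u)) \<and>
     (\<forall>m n. \<forall>u\<in>H. orth_proj ((V1 ^^ m) ` H) (orth_proj ((V2 ^^ n) ` H) u) =
                   orth_proj ((V2 ^^ n) ` H) (orth_proj ((V1 ^^ m) ` H) u))"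

end

theory Submission
  imports Defs
begin

text \<open>
  Translating the hypothesis by the unitaries \<open>w\<^sup>i z\<^sup>j\<close>, the projections onto all the spaces
  \<open>w\<^sup>i z\<^sup>j M\<close>, \<open>i\<close> and \<open>j\<close> arbitrary integers, commute. Hence they also commute with the
  projections onto \<open>A i\<close>, the closure of the union over \<open>n\<close> of \<open>w\<^sup>i z\<^sup>n M\<close>, and onto \<open>B j\<close>, the
  closure of the union over \<open>m\<close> of \<open>w\<^sup>m z\<^sup>j M\<close>, and the latter commute with each other. Since
  \<open>M\<close> lies in the Hardy space, the \<open>A i\<close> decrease to zero, and so do the \<open>B j\<close>; therefore \<open>M\<close>
  is the orthogonal sum of its intersections with \<open>W i j\<close>, the part of \<open>A i \<inter> B j\<close> orthogonal
  to \<open>A (i + 1)\<close> and \<open>B (j + 1)\<close>. Now \<open>W i j\<close> is \<open>w\<^sup>i z\<^sup>j\<close> times the wandering space \<open>W 0 0\<close>. For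
  \<open>f\<close>, \<open>g\<close> in \<open>W 0 0\<close> all Fourier coefficients of \<open>f * cnj g\<close> except the constant one
  vanish, so \<open>f * cnj g\<close> is constant: \<open>W 0 0\<close> is spanned by one unimodular function \<open>\<phi>\<close>, and
  \<open>M\<close> is spanned by the functions \<open>w\<^sup>i z\<^sup>j \<phi>\<close> that it contains.
\<close>


section \<open>Fourier uniqueness for integrable functions on the torus\<close>

lemma integral_circle:
  fixes f :: "complex \<Rightarrow> complex"
  assumes "f \<in> borel_measurable borel"
  shows "(\<integral>x. f x \<partial>circle) = (\<integral>t. indicator {0..2*pi} t *\<^sub>R f (cis t) \<partial>lborel) /\<^sub>R (2 * pi)"
    (is "_ = ?R")
proof -
  have c: "cis \<in> borel_measurable borel"
    by (intro borel_measurable_continuous_onI continuous_intros)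
  have m: "cis \<in> uniform_measure lborel {0..2 * pi} \<rightarrow>\<^sub>M restrict_space borel (sphere 0 1)"
    using c by (intro measurable_restrict_space2) auto
  have "(\<integral>x. f x \<partial>circle) = (\<integral>t. f (cis t) \<partial>uniform_measure lborel {0..2 * pi})"
    unfolding circle_def using assms by (intro integral_distr[OF m] measurable_restrict_space1)
  also have "uniform_measure lborel {0..2 * pi} =
      density lborel (\<lambda>t. ennreal (indicator {0..2*pi} t / (2 * pi)))"
    unfolding uniform_measure_def
  proof (intro density_cong AE_I2)
    \<comment> \<open>\<open>uniform_measure\<close> forms its density by division in
      \<open>ennreal\<close>, whereas \<open>integral_density\<close> asks for the image of a real
      function.\<close>
    have "(1 :: ennreal) / ennreal (2 * pi) = ennreal (1 / (2 * pi))"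
      by (simp add: divide_ennreal flip: ennreal_1)
    then show "indicator {0..2*pi} t / emeasure lborel {0..2*pi} = ennreal (indicator {0..2*pi} t / (2 * pi))" for t
      by (cases "t \<in> {0..2*pi}") simp_all
  qed simp_all
  also have "(\<integral>t. f (cis t) \<partial>\<dots>) = (\<integral>t. (indicator {0..2*pi} t / (2 * pi)) *\<^sub>R f (cis t) \<partial>lborel)"
  proof (rule integral_density)
    show "(\<lambda>t. f (cis t)) \<in> borel_measurable lborel"
      using measurable_compose[OF c assms] by simp
  qed simp_all
  also have "\<dots> = (\<integral>t. (1 / (2 * pi)) *\<^sub>R (indicator {0..2*pi} t *\<^sub>R f (cis t)) \<partial>lborel)"
    by (intro Bochner_Integration.integral_cong) auto
  also have "\<dots> = ?R"
    by (simp only: integral_scaleR_right inverse_eq_divide)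
  finally show ?thesis .
qed

lemma borel_measurable_powi [measurable]:
  "(\<lambda>x :: complex. x powi i) \<in> borel_measurable borel"
  by (cases "i \<ge> 0") (auto simp: power_int_def)

lemma integral_circle_powi:
  "(\<integral>x. x powi k \<partial>circle) = (if k = 0 then 1 else 0)"
proof (cases "k = 0")
  case True
  interpret prob_space circle by (rule prob_space_circle)
  show ?thesis using True by (simp add: prob_space)
next
  case False
  have cis: "cis t powi k = cis (of_int k * t)" for t
    by (rule cis_power_int)
  have "(\<integral>t. indicator {0..2*pi} t *\<^sub>R cis (of_int k * t) \<partial>lborel) =
      cis (of_int k * (2 * pi)) / (\<i> * of_int k) - cis (of_int k * 0) / (\<i> * of_int k)"
  proof (rule integral_FTC_Icc)
    fix t :: real
    have "((\<lambda>t. exp (\<i> * of_int k * of_real t) / (\<i> * of_int k)) has_vector_derivative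
        exp (\<i> * of_int k * of_real t)) (at t within {0..2*pi})"
      using False by (auto intro!: derivative_eq_intros has_vector_derivative_real_field)
    then show "((\<lambda>t. cis (of_int k * t) / (\<i> * of_int k)) has_vector_derivative
        cis (of_int k * t)) (at t within {0..2*pi})"
      by (simp add: cis_conv_exp mult.assoc)
  qed (auto intro!: continuous_intros)
  \<comment> \<open>A multiple of the full turn: the two boundary values of the antiderivative
    cancel.\<close>
  also have "cis (of_int k * (2 * pi)) = 1"
    by (metis cis_multiple_2pi Ints_of_int mult.commute mult.assoc)
  finally show ?thesis
    using False by (subst integral_circle) (auto simp: cis)
qed

lemma borel_measurable_torus [measurable (raw)]:
  "f \<in> borel_measurable (borel :: (complex \<times> complex) measure) \<Longrightarrow> f \<in> borel_measurable torus"
proof (rule measurable_compose[of "\<lambda>x. x" torus borel])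
  have "(\<lambda>x. x) \<in> circle \<rightarrow>\<^sub>M borel"
    by (simp add: circle_def measurable_restrict_space1)
  note measurable_compose[OF measurable_fst this, measurable (raw)]
    measurable_compose[OF measurable_snd this, measurable (raw)]
  show "(\<lambda>x. x) \<in> torus \<rightarrow>\<^sub>M borel"
    unfolding torus_def borel_prod[symmetric] by (subst measurable_pair_iff) (simp add: comp_def)
qed

text \<open>Uniqueness is proved by an induction over Borel sets of the ambient space, which closed
  sets generate; this inclusion brings the result back to the torus.\<close>

lemma sets_torus_subset_borel: "sets torus \<subseteq> sets borel"
proof -
  have "sets circle \<subseteq> sets borel"
    by (auto simp: circle_def sets_restrict_space)
  then have "sets (circle \<Otimes>\<^sub>M circle) \<subseteq> sets (borel \<Otimes>\<^sub>M borel)"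
    unfolding sets_pair_measure[of circle circle]
    by (intro sets.sigma_sets_subset') (auto simp: circle_def space_restrict_space)
  then show ?thesis
    unfolding torus_def borel_prod .
qed

text \<open>An honest function, unlike the class \<open>monomial\<close>, so that its multiplicative
  identities hold at every point of the torus and not merely almost everywhere.\<close>

definition torus_monomial :: "int \<Rightarrow> int \<Rightarrow> complex \<times> complex \<Rightarrow> complex" where
  "torus_monomial i j x = fst x powi i * snd x powi j"

lemma torus_monomial_measurable [measurable]: "torus_monomial i j \<in> borel_measurable torus"
proof (rule borel_measurable_torus)
  show "torus_monomial i j \<in> borel_measurable borel"
    unfolding torus_monomial_def [abs_def] borel_prod[symmetric] by measurable
qed

lemma norm_torus_monomial: "x \<in> space torus \<Longrightarrow> cmod (torus_monomial i j x) = 1"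
  by (auto simp: torus_monomial_def space_torus norm_mult norm_power_int)

lemma torus_monomial_mult:
  "x \<in> space torus \<Longrightarrow> torus_monomial i j x * torus_monomial k l x = torus_monomial (i + k) (j + l) x"
  by (subgoal_tac "fst x \<noteq> 0 \<and> snd x \<noteq> 0")
    (auto simp: torus_monomial_def space_torus power_int_add mult_ac)

lemma cnj_torus_monomial:
  "x \<in> space torus \<Longrightarrow> cnj (torus_monomial i j x) = torus_monomial (- i) (- j) x"
proof -
  have *: "cnj z powi i = z powi (- i)" if "cmod z = 1" for z i
  proof -
    have "cnj z = inverse z"
      using that by (metis complex_norm_square inverse_unique mult.commute of_real_1 one_power2)
    then show ?thesis by (metis power_int_inverse power_int_minus)
  qed
  show "x \<in> space torus \<Longrightarrow> ?thesis"
    by (auto simp: torus_monomial_def space_torus *)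
qed

lemma integral_torus_monomial:
  "(\<integral>x. torus_monomial i j x \<partial>torus) = (if i = 0 \<and> j = 0 then 1 else 0)"
proof -
  interpret C: prob_space circle by (rule prob_space_circle)
  interpret P: pair_prob_space circle circle by unfold_locales
  interpret T: prob_space torus by (rule prob_space_torus)
  have "integrable torus (torus_monomial i j)"
    by (intro T.integrable_const_bound[where B = 1] AE_I2) (auto simp: norm_torus_monomial)
  then have "(\<integral>x. torus_monomial i j x \<partial>torus) = (\<integral>x. (\<integral>y. torus_monomial i j (x, y) \<partial>circle) \<partial>circle)"
    unfolding torus_def by (rule P.integral_fst'[symmetric])
  also have "\<dots> = (\<integral>x. x powi i * (if j = 0 then 1 else 0) \<partial>circle)"
    by (simp add: torus_monomial_def integral_circle_powi)
  also have "\<dots> = (if i = 0 \<and> j = 0 then 1 else 0)"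
    by (cases "j = 0") (auto simp: integral_circle_powi)
  finally show ?thesis .
qed

section \<open>Integrable functions with vanishing Fourier coefficients\<close>

text \<open>Integrability is the right condition because the notion is applied to products
  \<open>f * cnj g\<close> of two square-integrable functions. As all integer exponents occur,
  testing against monomials amounts to testing against their conjugates.\<close>

definition fourier_null :: "(complex \<times> complex \<Rightarrow> complex) \<Rightarrow> bool" where
  "fourier_null f \<longleftrightarrow>
     integrable torus f \<and> (\<forall>i j. (\<integral>x. torus_monomial i j x * f x \<partial>torus) = 0)"

lemma integrable_torus_monomial_mult:
  "integrable torus f \<Longrightarrow> integrable torus (\<lambda>x. torus_monomial i j x * f x)"
  by (rule Bochner_Integration.integrable_bound[of torus f])
    (auto simp: norm_mult norm_torus_monomial)

lemma fourier_null_add: "fourier_null f \<Longrightarrow> fourier_null g \<Longrightarrow> fourier_null (\<lambda>x. f x + g x)"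
  by (auto simp: fourier_null_def distrib_left integrable_torus_monomial_mult)

lemma fourier_null_scale: "fourier_null f \<Longrightarrow> fourier_null (\<lambda>x. c * f x)"
proof -
  have "torus_monomial i j x * (c * f x) = c * (torus_monomial i j x * f x)" for i j x
    by simp
  then have "(\<integral>x. torus_monomial i j x * (c * f x) \<partial>torus) =
      c * (\<integral>x. torus_monomial i j x * f x \<partial>torus)" for i j
    by (simp only: integral_mult_right_zero)
  then show "fourier_null f \<Longrightarrow> fourier_null (\<lambda>x. c * f x)"
    by (simp add: fourier_null_def)
qed

lemma fourier_null_monomial:
  assumes "fourier_null f"
  shows "fourier_null (\<lambda>x. torus_monomial k l x * f x)"
proof -
  have "(\<integral>x. torus_monomial i j x * (torus_monomial k l x * f x) \<partial>torus) =
      (\<integral>x. torus_monomial (i + k) (j + l) x * f x \<partial>torus)" for i j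
    by (intro Bochner_Integration.integral_cong refl)
      (simp add: torus_monomial_mult mult.assoc [symmetric])
  with assms show ?thesis
    by (simp add: fourier_null_def integrable_torus_monomial_mult)
qed

lemma fourier_null_cong:
  assumes "\<And>x. x \<in> space torus \<Longrightarrow> f x = g x"
  shows "fourier_null f \<longleftrightarrow> fourier_null g"
proof -
  have "integrable torus f \<longleftrightarrow> integrable torus g"
    using assms by (intro Bochner_Integration.integrable_cong refl)
  moreover have "(\<integral>x. torus_monomial i j x * f x \<partial>torus) = (\<integral>x. torus_monomial i j x * g x \<partial>torus)" for i j
    using assms by (intro Bochner_Integration.integral_cong refl) simp
  ultimately show ?thesis by (simp add: fourier_null_def)
qed

text \<open>On the torus the real coordinates are combinations of \<open>w\<close>, \<open>z\<close>
  and their conjugates, that is, of monomials, and a monomial factor only translates the Fourier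
  coefficients. \<open>f\<close> is generalized because the product case applies the hypothesis for
  \<open>p\<close> to \<open>q\<close> times \<open>f\<close>.\<close>

lemma fourier_null_mult_polynomial:
  "real_polynomial_function p \<Longrightarrow> fourier_null f \<Longrightarrow> fourier_null (\<lambda>x. of_real (p x) * f x)"
proof (induction arbitrary: f rule: real_polynomial_function.induct)
  case (linear p)
  interpret bounded_linear p by (rule linear.hyps)
  have p: "p x = Re (fst x) * p (1, 0) + Im (fst x) * p (\<i>, 0) +
      Re (snd x) * p (0, 1) + Im (snd x) * p (0, \<i>)" for x
  proof -
    have "x = Re (fst x) *\<^sub>R (1, 0) + Im (fst x) *\<^sub>R (\<i>, 0) + Re (snd x) *\<^sub>R (0, 1) + Im (snd x) *\<^sub>R (0, \<i>)"
      by (auto simp: prod_eq_iff complex_eq_iff)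
    then have "p x = p (Re (fst x) *\<^sub>R (1, 0) + Im (fst x) *\<^sub>R (\<i>, 0) + Re (snd x) *\<^sub>R (0, 1) + Im (snd x) *\<^sub>R (0, \<i>))"
      by (rule arg_cong)
    then show ?thesis by (simp only: add scaleR real_scaleR_def)
  qed
  \<comment> \<open>For a coordinate function, \<open>s = 1\<close> gives \<open>f\<close> times
    twice its real part, and \<open>s = - 1\<close> gives \<open>f\<close> times
    \<open>2 * \<i>\<close> times its imaginary part.\<close>
  define L where "L i j s x = torus_monomial i j x * f x + s * (torus_monomial (- i) (- j) x * f x)"
    for i j and s :: complex and x
  have L: "fourier_null (\<lambda>x. c * L i j s x)" for c i j s
    unfolding L_def
    by (intro fourier_null_scale fourier_null_add fourier_null_monomial linear.prems)
  have "fourier_null (\<lambda>x. (of_real (p (1, 0)) / 2) * L 1 0 1 x + (of_real (p (\<i>, 0)) / (2 * \<i>)) * L 1 0 (- 1) x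
     + (of_real (p (0, 1)) / 2) * L 0 1 1 x + (of_real (p (0, \<i>)) / (2 * \<i>)) * L 0 1 (- 1) x)"
    by (intro fourier_null_add L)
  also have "?this \<longleftrightarrow> ?case"
  proof (rule fourier_null_cong)
    fix x assume x: "x \<in> space torus"
    have *: "torus_monomial (- 1) 0 x = cnj (fst x)" "torus_monomial 0 (- 1) x = cnj (snd x)"
      using cnj_torus_monomial[OF x, of 1 0] cnj_torus_monomial[OF x, of 0 1]
      by (simp_all add: torus_monomial_def)
    have **: "torus_monomial 1 0 x = fst x" "torus_monomial 0 1 x = snd x"
      by (simp_all add: torus_monomial_def)
    have re: "z + cnj z = 2 * of_real (Re z)" "z - cnj z = 2 * \<i> * of_real (Im z)" for z
      by (auto simp: complex_eq_iff)
    have L1: "L 1 0 1 x = 2 * of_real (Re (fst x)) * f x" "L 0 1 1 x = 2 * of_real (Re (snd x)) * f x"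
       "L 1 0 (-1) x = 2 * \<i> * of_real (Im (fst x)) * f x" "L 0 1 (-1) x = 2 * \<i> * of_real (Im (snd x)) * f x"
      unfolding re[symmetric] by (simp_all add: L_def * ** algebra_simps)
    show "(of_real (p (1, 0)) / 2) * L 1 0 1 x + (of_real (p (\<i>, 0)) / (2 * \<i>)) * L 1 0 (- 1) x
     + (of_real (p (0, 1)) / 2) * L 0 1 1 x + (of_real (p (0, \<i>)) / (2 * \<i>)) * L 0 1 (- 1) x =
       of_real (p x) * f x"
      unfolding L1 by (subst p) (simp add: field_simps)
  qed
  finally show ?case .
next
  case (mult p q)
  have "fourier_null (\<lambda>x. of_real (p x) * (of_real (q x) * f x))"
    using mult by blast
  then show ?case by (simp add: mult.assoc)
next
  case (add p q)
  then show ?case by (simp add: distrib_right fourier_null_add)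
next
  case (const c)
  then show ?case by (rule fourier_null_scale)
qed

text \<open>Stone-Weierstrass on the compact torus: polynomials integrate to 0 against
  \<open>f\<close>, and the error is at most the uniform distance times the L1 norm of
  \<open>f\<close>.\<close>

lemma fourier_null_integral_continuous:
  assumes f: "fourier_null f" and h: "continuous_on UNIV h"
  shows "(\<integral>x. of_real (h x) * f x \<partial>torus) = 0"
proof -
  have int: "integrable torus f" using f by (simp add: fourier_null_def)
  have compact: "compact (sphere 0 1 \<times> sphere 0 1 :: (complex \<times> complex) set)"
    by (intro compact_Times compact_sphere)
  define I where "I = (\<integral>x. cmod (f x) \<partial>torus)"
  have I: "I \<ge> 0" by (simp add: I_def)
  have hm [measurable]: "h \<in> borel_measurable torus"
    using h by (intro borel_measurable_torus borel_measurable_continuous_onI)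
  note [measurable] = borel_measurable_integrable[OF int]
  have "norm (\<integral>x. of_real (h x) * f x \<partial>torus) \<le> e" if "e > 0" for e
  proof -
    \<comment> \<open>The added 1 keeps the tolerance meaningful when the L1 norm \<open>I\<close>
      is 0.\<close>
    obtain p where p: "real_polynomial_function p"
      and close: "\<And>x. x \<in> sphere 0 1 \<times> sphere 0 1 \<Longrightarrow> \<bar>h x - p x\<bar> < e / (I + 1)"
      using Stone_Weierstrass_real_polynomial_function[OF compact, of h "e / (I + 1)"] h \<open>e > 0\<close> I
      by (auto intro: continuous_on_subset)
    have null: "fourier_null (\<lambda>x. of_real (p x) * f x)"
      by (rule fourier_null_mult_polynomial[OF p f])
    then have "(\<integral>x. torus_monomial 0 0 x * (of_real (p x) * f x) \<partial>torus) = 0"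
      unfolding fourier_null_def by blast
    then have p0: "(\<integral>x. of_real (p x) * f x \<partial>torus) = 0"
      by (simp add: torus_monomial_def)
    have ip: "integrable torus (\<lambda>x. of_real (p x) * f x)"
      using null by (simp add: fourier_null_def)
    have pm [measurable]: "p \<in> borel_measurable torus"
      by (intro borel_measurable_torus borel_measurable_continuous_onI
          continuous_on_polymonial_function) (use p real_polynomial_function_eq in auto)
    have bound: "norm (of_real (h x - p x) * f x) \<le> e / (I + 1) * cmod (f x)" if "x \<in> space torus" for x
      unfolding norm_mult using close[of x] that
      by (intro mult_right_mono) (auto simp: space_torus simp flip: of_real_diff)
    have ihp: "integrable torus (\<lambda>x. of_real (h x - p x) * f x)"
    proof (rule Bochner_Integration.integrable_bound)
      show "integrable torus (\<lambda>x. e / (I + 1) * cmod (f x))" using int by simp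
      show "AE x in torus. norm (of_real (h x - p x) * f x) \<le> norm (e / (I + 1) * cmod (f x))"
        using bound I \<open>e > 0\<close> by (intro AE_I2) auto
    qed measurable
    have "(\<integral>x. of_real (h x) * f x \<partial>torus) = (\<integral>x. of_real (h x - p x) * f x + of_real (p x) * f x \<partial>torus)"
      by (simp add: algebra_simps)
    also have "\<dots> = (\<integral>x. of_real (h x - p x) * f x \<partial>torus)"
      using ihp ip p0 by simp
    also have "norm \<dots> \<le> (\<integral>x. e / (I + 1) * cmod (f x) \<partial>torus)"
      using int bound by (intro Bochner_Integration.integral_norm_bound_integral ihp) auto
    also have "\<dots> = e * (I / (I + 1))" by (simp add: I_def)
    also have "\<dots> \<le> e * 1" using I \<open>e > 0\<close> by (intro mult_left_mono) auto
    finally show ?thesis by simp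
  qed
  then have "norm (\<integral>x. of_real (h x) * f x \<partial>torus) \<le> 0"
    by (rule field_le_epsilon) auto
  then show ?thesis by simp
qed

text \<open>The powers of a continuous function that equals 1 on \<open>C\<close> and is smaller
  than 1 elsewhere tend to the indicator of \<open>C\<close>; dominated convergence does the
  rest.\<close>

lemma fourier_null_integral_closed:
  assumes f: "fourier_null f" and C: "closed C"
  shows "(\<integral>x. indicator C x *\<^sub>R f x \<partial>torus) = 0"
\<comment> \<open>\<open>infdist\<close> to the empty set is 0 by convention, so \<open>h\<close>
  would be 1 everywhere in that case.\<close>
proof (cases "C = {}")
  case False
  have int: "integrable torus f" using f by (simp add: fourier_null_def)
  note [measurable] = borel_measurable_integrable[OF int]
  define h where "h = (\<lambda>x. 1 / (1 + infdist x C))"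
  have ge: "infdist x C \<ge> 0" for x by (rule infdist_nonneg)
  have cont: "continuous_on UNIV (\<lambda>x. h x ^ n)" for n
    unfolding h_def using ge
    by (intro continuous_intros) (metis add_nonneg_eq_0_iff zero_le_one zero_neq_one)
  have hm: "(\<lambda>x. h x ^ n) \<in> borel_measurable torus" for n
    using cont by (intro borel_measurable_torus borel_measurable_continuous_onI)
  have h01: "0 \<le> h x" "h x \<le> 1" for x
    using ge[of x] by (auto simp: h_def)
  have lim: "(\<lambda>n. h x ^ n) \<longlonglongrightarrow> indicator C x" for x
  proof (cases "x \<in> C")
    case True then show ?thesis by (simp add: h_def)
  next
    case False
    then have "infdist x C > 0"
      using in_closed_iff_infdist_zero[OF C \<open>C \<noteq> {}\<close>] ge[of x] by (auto simp: less_le)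
    then have "h x < 1" by (simp add: h_def)
    with h01[of x] False show ?thesis by (auto intro!: LIMSEQ_realpow_zero)
  qed
  have "(\<lambda>n. \<integral>x. of_real (h x ^ n) * f x \<partial>torus) \<longlonglongrightarrow> (\<integral>x. indicator C x *\<^sub>R f x \<partial>torus)"
  proof (rule integral_dominated_convergence[where w = "\<lambda>x. norm (f x)"])
    show "(\<lambda>x. of_real (h x ^ n) * f x) \<in> borel_measurable torus" for n
      using hm[of n] by (intro borel_measurable_times measurable_compose[OF _ borel_measurable_of_real]) auto
    have "indicator C \<in> borel_measurable torus"
      using C by (intro borel_measurable_torus borel_measurable_indicator) auto
    then show "(\<lambda>x. indicator C x *\<^sub>R f x) \<in> borel_measurable torus"
      by (intro borel_measurable_scaleR) auto
    show "AE x in torus. (\<lambda>n. of_real (h x ^ n) * f x) \<longlonglongrightarrow> indicator C x *\<^sub>R f x"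
      unfolding scaleR_conv_of_real by (intro AE_I2 tendsto_mult tendsto_of_real lim tendsto_const)
    show "AE x in torus. norm (of_real (h x ^ n) * f x) \<le> norm (f x)" for n
      using h01 by (intro AE_I2) (auto simp: norm_mult norm_power intro!: mult_left_le_one_le power_le_one)
  qed (use int in auto)
  moreover have "(\<integral>x. of_real (h x ^ n) * f x \<partial>torus) = 0" for n
    using fourier_null_integral_continuous[OF f cont] .
  ultimately show ?thesis by (simp only: LIMSEQ_const_iff)
qed simp

text \<open>The closed sets generate the Borel sets and are stable under intersection, and vanishing
  of the integral over a set passes to complements and disjoint countable unions. So the integral of
  \<open>f\<close> vanishes over every measurable set.\<close>

lemma fourier_null_AE_zero:
  assumes f: "fourier_null f"
  shows "AE x in torus. f x = 0"
proof -
  interpret prob_space torus by (rule prob_space_torus)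
  have int: "integrable torus f" using f by (simp add: fourier_null_def)
  have borel: "sets (borel :: (complex \<times> complex) measure) = sigma_sets UNIV (Collect closed)"
    by (simp add: borel_eq_closed)
  have ind: "integrable torus (\<lambda>x. indicator A x *\<^sub>R f x)" if "A \<in> sets borel" for A
  proof (rule Bochner_Integration.integrable_bound[OF int])
    have "indicator A \<in> borel_measurable torus"
      using that by (intro borel_measurable_torus borel_measurable_indicator) auto
    then show "(\<lambda>x. indicator A x *\<^sub>R f x) \<in> borel_measurable torus"
      using int by (intro borel_measurable_scaleR) auto
    show "AE x in torus. norm (indicator A x *\<^sub>R f x) \<le> norm (f x)"
      by (auto simp: indicator_def)
  qed
  have "(\<integral>x. indicator A x *\<^sub>R f x \<partial>torus) = 0" if "A \<in> sets borel" for A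
  proof -
    have "Int_stable (Collect closed :: (complex \<times> complex) set set)"
      by (auto simp: Int_stable_def)
    moreover have "Collect closed \<subseteq> Pow (UNIV :: (complex \<times> complex) set)"
      by simp
    moreover have "A \<in> sigma_sets UNIV (Collect closed)"
      using that borel by simp
    ultimately show ?thesis
    proof (induction A rule: sigma_sets_induct_disjoint)
      case (basic A)
      then show ?case using fourier_null_integral_closed[OF f] by simp
    next
      case (compl A)
      then have "A \<in> sets borel" using borel by simp
      have "(\<integral>x. indicator (UNIV - A) x *\<^sub>R f x \<partial>torus) =
          (\<integral>x. indicator UNIV x *\<^sub>R f x - indicator A x *\<^sub>R f x \<partial>torus)"
        by (intro Bochner_Integration.integral_cong) (auto simp: indicator_def)
      also have "\<dots> = (\<integral>x. indicator UNIV x *\<^sub>R f x \<partial>torus) - (\<integral>x. indicator A x *\<^sub>R f x \<partial>torus)"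
        by (intro Bochner_Integration.integral_diff ind \<open>A \<in> sets borel\<close>) auto
      also have "\<dots> = 0"
        using compl fourier_null_integral_closed[OF f closed_UNIV] by simp
      finally show ?case .
    next
      case (union A)
      have A: "A i \<in> sets borel" for i using union borel by auto
      \<comment> \<open>Countable additivity of set integrals asks for members of
        \<open>sets torus\<close>; cutting with the space does not change the integrals.\<close>
      have AT: "A i \<inter> space torus \<in> sets torus" for i
        using measurable_sets[OF borel_measurable_torus[OF measurable_ident] A[of i]] by simp
      have cut: "(LINT x:B \<inter> space torus|torus. f x) = (\<integral>x. indicator B x *\<^sub>R f x \<partial>torus)" for B
        unfolding set_lebesgue_integral_def
        by (intro Bochner_Integration.integral_cong) (auto simp: indicator_def)
      have "(LINT x:(\<Union>i. A i \<inter> space torus)|torus. f x) = (\<Sum>i. (LINT x:(A i \<inter> space torus)|torus. f x))"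
      proof (rule lebesgue_integral_countable_add)
        show "(A i \<inter> space torus) \<inter> (A j \<inter> space torus) = {}" if "i \<noteq> j" for i j
          using \<open>disjoint_family A\<close> that by (auto simp: disjoint_family_on_def)
        have "(\<Union>i. A i \<inter> space torus) \<in> sets borel"
          using AT sets_torus_subset_borel by blast
        then show "set_integrable torus (\<Union>i. A i \<inter> space torus) f"
          unfolding set_integrable_def by (rule ind)
      qed (rule AT)
      also have "\<dots> = 0" using union cut by simp
      also have "(\<Union>i. A i \<inter> space torus) = (\<Union>i. A i) \<inter> space torus" by auto
      finally show ?case unfolding cut .
    qed simp_all
  qed
  then have "(LINT x:A|torus. f x) = 0" if "A \<in> sets torus" for A
    using that sets_torus_subset_borel unfolding set_lebesgue_integral_def by blast
  then show ?thesis by (rule density_zero[OF int])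
qed


section \<open>Projections in the space of square-integrable functions\<close>

lemma square_integrable_rep: "square_integrable (rep_L2_torus u)"
  using L2_eq_rep[of u] by (simp add: L2_eq_def)

lemma rep_measurable [measurable]: "rep_L2_torus u \<in> borel_measurable torus"
  using square_integrable_rep by (rule square_integrable_measurable)

lemma L2_torus_eqI:
  assumes "AE x in torus. rep_L2_torus u x = rep_L2_torus v x"
  shows "u = v"
proof -
  have "L2_eq (rep_L2_torus u) (rep_L2_torus v)"
    using assms by (simp add: L2_eq_def square_integrable_rep)
  then show ?thesis
    using Quotient3_rel_rep[OF Quotient3_L2_torus] by blast
qed

lemma abs_rep_L2: "abs_L2_torus (rep_L2_torus u) = u"
  by (rule Quotient3_abs_rep[OF Quotient3_L2_torus])

lemma rep_zero: "AE x in torus. rep_L2_torus 0 x = 0"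
  unfolding zero_L2_torus_def by (rule rep_abs_L2[OF square_integrable_zero])

lemma rep_add: "AE x in torus. rep_L2_torus (u + v) x = rep_L2_torus u x + rep_L2_torus v x"
proof -
  have "u + v = abs_L2_torus (\<lambda>x. rep_L2_torus u x + rep_L2_torus v x)"
    using plus_L2_torus.abs_eq[OF L2_eq_rep L2_eq_rep, of u v] by (simp only: abs_rep_L2)
  then show ?thesis
    using rep_abs_L2[OF square_integrable_add[OF square_integrable_rep square_integrable_rep], of u v] by simp
qed

lemma rep_scaleC: "AE x in torus. rep_L2_torus (c *\<^sub>C u) x = c * rep_L2_torus u x"
proof -
  have "c *\<^sub>C u = abs_L2_torus (\<lambda>x. c * rep_L2_torus u x)"
    using scaleC.abs_eq[OF L2_eq_rep, of c u] by (simp only: abs_rep_L2)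
  then show ?thesis
    using rep_abs_L2[OF square_integrable_scale[OF square_integrable_rep], of c u] by simp
qed

lemma rep_diff: "AE x in torus. rep_L2_torus (u - v) x = rep_L2_torus u x - rep_L2_torus v x"
  using rep_add[of "u - v" v] by eventually_elim simp

lemma norm_L2_torus_sq: "(norm u)\<^sup>2 = (\<integral>x. (cmod (rep_L2_torus u x))\<^sup>2 \<partial>torus)"
  by (simp add: norm_L2_torus_def inner_L2_torus_def cinner_self)

lemma nn_integral_norm_L2_torus:
  "(\<integral>\<^sup>+x. ennreal ((cmod (rep_L2_torus u x))\<^sup>2) \<partial>torus) = ennreal ((norm u)\<^sup>2)"
  unfolding norm_L2_torus_sq using square_integrable_rep[of u]
  by (intro nn_integral_eq_integral) (auto simp: square_integrable_def)

text \<open>On a probability space the variance of the modulus is nonnegative, so the L1 norm is at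
  most the L2 norm.\<close>

lemma nn_integral_le_norm_L2_torus:
  "(\<integral>\<^sup>+x. ennreal (cmod (rep_L2_torus u x)) \<partial>torus) \<le> ennreal (norm u)"
proof -
  interpret prob_space torus by (rule prob_space_torus)
  let ?f = "\<lambda>x. cmod (rep_L2_torus u x)"
  have sq: "integrable torus (\<lambda>x. (?f x)\<^sup>2)"
    using square_integrable_rep[of u] by (simp add: square_integrable_def)
  then have int: "integrable torus ?f"
    by (rule square_integrable_imp_integrable[rotated]) simp
  have "0 \<le> variance ?f" by (rule variance_positive)
  then have "(expectation ?f)\<^sup>2 \<le> (norm u)\<^sup>2"
    using variance_eq[OF int sq] by (simp add: norm_L2_torus_sq)
  then have "expectation ?f \<le> norm u"
    by (rule power2_le_imp_le) simp
  then show ?thesis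
    using int by (subst nn_integral_eq_integral) (auto intro: ennreal_leI)
qed

lemma Cauchy_fast_subsequence:
  fixes X :: "nat \<Rightarrow> 'a :: metric_space"
  assumes "Cauchy X"
  obtains r where "strict_mono r" "\<And>n. dist (X (r (Suc n))) (X (r n)) < (1/2) ^ n"
proof -
  have "\<exists>N. \<forall>m\<ge>N. \<forall>k\<ge>N. dist (X m) (X k) < (1/2) ^ n" for n
    using assms by (auto simp: Cauchy_def)
  then obtain N where N: "\<And>n m k. m \<ge> N n \<Longrightarrow> k \<ge> N n \<Longrightarrow> dist (X m) (X k) < (1/2) ^ n"
    by metis
  define r where "r = rec_nat (N 0) (\<lambda>n a. max (Suc a) (N (Suc n)))"
  have r: "r (Suc n) = max (Suc (r n)) (N (Suc n))" for n
    by (simp add: r_def)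
  have ge: "r n \<ge> N n" for n
    by (cases n) (auto simp: r_def)
  have "strict_mono r"
    by (auto simp: strict_mono_Suc_iff r)
  moreover have "dist (X (r (Suc n))) (X (r n)) < (1/2) ^ n" for n
    using ge[of n] by (intro N) (auto simp: r)
  ultimately show ?thesis by (rule that)
qed

text \<open>Riesz--Fischer: a fast Cauchy subsequence converges almost everywhere, and Fatou's lemma
  turns this into convergence in norm.\<close>

lemma L2_torus_Cauchy_convergent:
  fixes X :: "nat \<Rightarrow> L2_torus"
  assumes "Cauchy X"
  shows "convergent X"
proof -
  obtain r where r: "strict_mono r" "\<And>n. dist (X (r (Suc n))) (X (r n)) < (1/2) ^ n"
    using Cauchy_fast_subsequence[OF assms] by blast
  define f where "f n = rep_L2_torus (X (r n))" for n
  define d where "d n = rep_L2_torus (X (r (Suc n)) - X (r n))" for n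
  have [measurable]: "f n \<in> borel_measurable torus" "d n \<in> borel_measurable torus" for n
    by (simp_all add: f_def d_def)
  \<comment> \<open>The L1 norms of the increments are bounded by a geometric series, so the
    increments are absolutely summable at almost every point.\<close>
  have "(\<integral>\<^sup>+x. (\<Sum>n. ennreal (cmod (d n x))) \<partial>torus) = (\<Sum>n. \<integral>\<^sup>+x. ennreal (cmod (d n x)) \<partial>torus)"
    by (rule nn_integral_suminf) measurable
  also have "\<dots> \<le> (\<Sum>n. ennreal ((1/2) ^ n))"
  proof (rule suminf_le)
    fix n
    have "(\<integral>\<^sup>+x. ennreal (cmod (d n x)) \<partial>torus) \<le> ennreal (norm (X (r (Suc n)) - X (r n)))"
      unfolding d_def by (rule nn_integral_le_norm_L2_torus)
    also have "\<dots> \<le> ennreal ((1/2) ^ n)"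
      using r(2)[of n] by (intro ennreal_leI) (simp add: dist_norm)
    finally show "(\<integral>\<^sup>+x. ennreal (cmod (d n x)) \<partial>torus) \<le> ennreal ((1/2) ^ n)" .
  qed auto
  also have "\<dots> < \<infinity>"
    unfolding infinity_ennreal_def less_top[symmetric]
    by (intro ennreal_suminf_neq_top summable_geometric) simp_all
  finally have "AE x in torus. (\<Sum>n. ennreal (cmod (d n x))) \<noteq> \<infinity>"
    by (intro nn_integral_noteq_infinite) auto
  then have summable: "AE x in torus. summable (\<lambda>n. d n x)"
  proof eventually_elim
    case (elim x)
    then have "summable (\<lambda>n. cmod (d n x))" by (intro summable_suminf_not_top) auto
    then show ?case by (rule summable_norm_cancel)
  qed
  have "AE x in torus. \<forall>n. d n x = f (Suc n) x - f n x"
    unfolding AE_all_countable d_def f_def by (intro allI rep_diff)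
  with summable have conv: "AE x in torus. convergent (\<lambda>n. f n x)"
  proof eventually_elim
    case (elim x)
    have "(\<Sum>k<n. d k x) = f n x - f 0 x" for n
      using elim(2) sum_lessThan_telescope[of "\<lambda>n. f n x" n] by simp
    then have "f n x = f 0 x + (\<Sum>k<n. d k x)" for n
      by simp
    then have "(\<lambda>n. f n x) = (\<lambda>n. f 0 x + (\<Sum>k<n. d k x))" ..
    also have "\<dots> \<longlonglongrightarrow> f 0 x + (\<Sum>n. d n x)"
      by (intro tendsto_add tendsto_const summable_LIMSEQ elim(1))
    finally show ?case by (rule convergentI)
  qed
  define F where "F x = lim (\<lambda>n. f n x)" for x
  have F [measurable]: "F \<in> borel_measurable torus"
    unfolding F_def by measurable
  \<comment> \<open>With \<open>n\<close> fixed, a bound on the tail differences is inherited by the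
    pointwise limit. Applied twice: with bound 1 to place \<open>F\<close> in L2, with bound
    \<open>e / 2\<close> to obtain convergence in norm.\<close>
  have Fatou: "(\<integral>\<^sup>+x. ennreal ((cmod (F x - f n x))\<^sup>2) \<partial>torus) \<le> ennreal (e\<^sup>2)"
    if le: "\<And>m. m \<ge> n \<Longrightarrow> norm (X (r m) - X (r n)) \<le> e" for n e
  proof -
    have "(\<integral>\<^sup>+x. ennreal ((cmod (F x - f n x))\<^sup>2) \<partial>torus) =
        (\<integral>\<^sup>+x. liminf (\<lambda>m. ennreal ((cmod (f m x - f n x))\<^sup>2)) \<partial>torus)"
    proof (rule nn_integral_cong_AE)
      show "AE x in torus. ennreal ((cmod (F x - f n x))\<^sup>2) = liminf (\<lambda>m. ennreal ((cmod (f m x - f n x))\<^sup>2))"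
        using conv
      proof eventually_elim
        case (elim x)
        then have "(\<lambda>m. f m x) \<longlonglongrightarrow> F x"
          by (simp add: F_def convergent_LIMSEQ_iff)
        then have "(\<lambda>m. ennreal ((cmod (f m x - f n x))\<^sup>2)) \<longlonglongrightarrow> ennreal ((cmod (F x - f n x))\<^sup>2)"
          by (intro tendsto_ennrealI tendsto_intros)
        then show ?case by (intro lim_imp_Liminf[symmetric]) auto
      qed
    qed
    also have "\<dots> \<le> liminf (\<lambda>m. \<integral>\<^sup>+x. ennreal ((cmod (f m x - f n x))\<^sup>2) \<partial>torus)"
      by (rule nn_integral_liminf) measurable
    also have "\<dots> \<le> liminf (\<lambda>m. ennreal (e\<^sup>2))"
    proof (rule Liminf_mono, rule eventually_sequentiallyI)
      fix m assume "m \<ge> n"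
      have "(\<integral>\<^sup>+x. ennreal ((cmod (f m x - f n x))\<^sup>2) \<partial>torus) =
          (\<integral>\<^sup>+x. ennreal ((cmod (rep_L2_torus (X (r m) - X (r n)) x))\<^sup>2) \<partial>torus)"
        unfolding f_def by (rule nn_integral_cong_AE,
          (use rep_diff[of "X (r m)" "X (r n)"] in eventually_elim),
          simp)
      also have "\<dots> = ennreal ((norm (X (r m) - X (r n)))\<^sup>2)"
        by (rule nn_integral_norm_L2_torus)
      also have "\<dots> \<le> ennreal (e\<^sup>2)"
        using le[OF \<open>m \<ge> n\<close>] by (intro ennreal_leI power_mono) auto
      finally show "(\<integral>\<^sup>+x. ennreal ((cmod (f m x - f n x))\<^sup>2) \<partial>torus) \<le> ennreal (e\<^sup>2)" .
    qed
    also have "\<dots> = ennreal (e\<^sup>2)" by (simp add: Liminf_const)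
    finally show ?thesis .
  qed
  have Cauchy_r: "\<exists>N. \<forall>n\<ge>N. \<forall>m\<ge>n. norm (X (r m) - X (r n)) \<le> e" if "e > 0" for e
  proof -
    have "Cauchy (X \<circ> r)" by (rule Cauchy_subseq_Cauchy[OF assms r(1)])
    from CauchyD[OF this that] obtain N
      where "\<forall>m\<ge>N. \<forall>n\<ge>N. norm ((X \<circ> r) m - (X \<circ> r) n) < e" by blast
    then have "\<forall>n\<ge>N. \<forall>m\<ge>n. norm (X (r m) - X (r n)) \<le> e"
      by (auto intro: less_imp_le)
    then show ?thesis ..
  qed
  have sq: "square_integrable F"
  proof -
    obtain N where "\<forall>n\<ge>N. \<forall>m\<ge>n. norm (X (r m) - X (r n)) \<le> 1"
      using Cauchy_r[of 1] by auto
    then have "(\<integral>\<^sup>+x. ennreal ((cmod (F x - f N x))\<^sup>2) \<partial>torus) \<le> ennreal (1\<^sup>2)"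
      by (intro Fatou) auto
    also have "\<dots> < \<infinity>" by simp
    finally have "integrable torus (\<lambda>x. (cmod (F x - f N x))\<^sup>2)"
      by (intro integrableI_bounded) auto
    then have "square_integrable (\<lambda>x. F x - f N x)"
      by (simp add: square_integrable_def)
    then have "square_integrable (\<lambda>x. (F x - f N x) + f N x)"
      using square_integrable_rep[of "X (r N)"] unfolding f_def by (rule square_integrable_add)
    then show ?thesis by simp
  qed
  have lim: "(\<lambda>n. X (r n)) \<longlonglongrightarrow> abs_L2_torus F"
  proof (rule LIMSEQ_I)
    fix e :: real assume "e > 0"
    then obtain N where N: "\<forall>n\<ge>N. \<forall>m\<ge>n. norm (X (r m) - X (r n)) \<le> e / 2"
      using Cauchy_r[of "e / 2"] by auto
    have "norm (X (r n) - abs_L2_torus F) < e" if "n \<ge> N" for n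
    proof -
      have "ennreal ((norm (abs_L2_torus F - X (r n)))\<^sup>2) =
          (\<integral>\<^sup>+x. ennreal ((cmod (rep_L2_torus (abs_L2_torus F - X (r n)) x))\<^sup>2) \<partial>torus)"
        by (rule nn_integral_norm_L2_torus[symmetric])
      also have "\<dots> = (\<integral>\<^sup>+x. ennreal ((cmod (F x - f n x))\<^sup>2) \<partial>torus)"
        unfolding f_def by (rule nn_integral_cong_AE,
          (use rep_diff[of "abs_L2_torus F" "X (r n)"] rep_abs_L2[OF sq] in eventually_elim),
          simp)
      also have "\<dots> \<le> ennreal ((e / 2)\<^sup>2)"
        using N that by (intro Fatou) auto
      finally have "(norm (abs_L2_torus F - X (r n)))\<^sup>2 \<le> (e / 2)\<^sup>2"
        by (simp add: ennreal_le_iff)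
      then have "norm (abs_L2_torus F - X (r n)) \<le> e / 2"
        by (rule power2_le_imp_le) (use \<open>e > 0\<close> in simp)
      then show ?thesis using \<open>e > 0\<close> by (simp add: norm_minus_commute)
    qed
    then show "\<exists>N. \<forall>n\<ge>N. norm (X (r n) - abs_L2_torus F) < e" by blast
  qed
  show ?thesis
    using Cauchy_converges_subseq[OF assms r(1), of "abs_L2_torus F"] lim
    by (auto simp: comp_def convergent_def)
qed

section \<open>The complex inner product\<close>

lemma cinner_add_right: "cinner u (v + w) = cinner u v + cinner u w"
  by (metis cinner_add_left cinner_commute complex_cnj_add)

lemma cinner_scaleC_right: "cinner u (c *\<^sub>C v) = cnj c * cinner u v"
  by (metis cinner_scaleC_left cinner_commute complex_cnj_mult)

lemma cinner_zero_left [simp]: "cinner 0 u = 0"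
  using cinner_scaleC_left[of 0 u u] by simp

lemma cinner_zero_right [simp]: "cinner u 0 = 0"
  using cinner_scaleC_right[of u 0 u] by simp

lemma cinner_diff_left: "cinner (u - v) w = cinner u w - cinner v w"
  using cinner_add_left[of "u - v" v w] by simp

lemma cinner_self_norm: "cinner u u = of_real ((norm u)\<^sup>2)"
  by (simp add: cinner_self norm_L2_torus_sq)

lemma cinner_self_zero_iff: "cinner u u = 0 \<longleftrightarrow> u = 0"
  by (simp add: cinner_self_norm)

lemma cinner_eq_zero_sym: "cinner u v = 0 \<longleftrightarrow> cinner v u = 0"
  by (metis cinner_commute complex_cnj_zero)

lemma norm_scaleC: "norm (c *\<^sub>C u) = cmod c * norm u"
proof -
  have "of_real ((norm (c *\<^sub>C u))\<^sup>2) = (c * cnj c) * of_real ((norm u)\<^sup>2)"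
    unfolding cinner_self_norm[symmetric] by (simp add: cinner_scaleC_left cinner_scaleC_right)
  also have "\<dots> = of_real ((cmod c * norm u)\<^sup>2)"
    by (simp add: complex_norm_square[symmetric] power_mult_distrib)
  finally have "(norm (c *\<^sub>C u))\<^sup>2 = (cmod c * norm u)\<^sup>2"
    by (simp only: of_real_eq_iff)
  then show ?thesis by (simp add: power2_eq_iff_nonneg)
qed

text \<open>A unimodular factor \<open>a\<close> rotates the inner product onto its modulus, where
  the real Cauchy-Schwarz inequality applies.\<close>

lemma cmod_cinner_le: "cmod (cinner u v) \<le> norm u * norm v"
proof (cases "cinner u v = 0")
  case False
  define a where "a = cnj (sgn (cinner u v))"
  have a: "cmod a = 1" using False by (simp add: a_def norm_sgn)
  have "a * cinner u v = of_real (cmod (cinner u v))"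
    using False by (simp add: a_def sgn_div_norm scaleR_conv_of_real mult.commute
        complex_norm_square[symmetric] field_simps power2_eq_square[symmetric])
  then have "cmod (cinner u v) = inner (a *\<^sub>C u) v"
    by (simp add: inner_L2_torus_def cinner_scaleC_left)
  also have "\<dots> \<le> norm (a *\<^sub>C u) * norm v" by (rule norm_cauchy_schwarz)
  finally show ?thesis by (simp add: norm_scaleC a)
qed simp

lemma bounded_linear_cinner_left: "bounded_linear (\<lambda>u. cinner u v)"
proof (rule bounded_linear_intro[where K = "norm v"])
  show "cinner (r *\<^sub>R u) v = r *\<^sub>R cinner u v" for r u
    by (simp add: scaleR_L2_torus_def cinner_scaleC_left scaleR_conv_of_real)
qed (simp_all add: cinner_add_left cmod_cinner_le)

lemma continuous_on_cinner_left: "continuous_on A (\<lambda>u. cinner u v)"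
  by (intro linear_continuous_on bounded_linear_cinner_left)

text \<open>The nearest-point argument yields orthogonality for the real inner product only; testing
  with \<open>\<i>\<close> times \<open>s\<close> supplies the imaginary part.\<close>

lemma cinner_zero_all_inner:
  assumes "L2.subspace S" "\<And>s. s \<in> S \<Longrightarrow> inner w s = 0" "s \<in> S"
  shows "cinner w s = 0"
proof (rule complex_eqI)
  show "Re (cinner w s) = Re 0" using assms by (simp add: inner_L2_torus_def)
  have "\<i> *\<^sub>C s \<in> S" using assms by (intro L2.subspace_scale)
  then have "Re (cinner w (\<i> *\<^sub>C s)) = 0"
    using assms(2) by (simp add: inner_L2_torus_def)
  then show "Im (cinner w s) = Im 0" by (simp add: cinner_scaleC_right)
qed

section \<open>Orthogonal projections onto closed subspaces\<close>

definition closed_subspace :: "L2_torus set \<Rightarrow> bool" where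
  "closed_subspace S \<longleftrightarrow> closed S \<and> L2.subspace S"

lemma subspace_scaleR: "L2.subspace S \<Longrightarrow> u \<in> S \<Longrightarrow> r *\<^sub>R u \<in> S"
  by (simp add: scaleR_L2_torus_def L2.subspace_scale)

text \<open>Midpoints of a minimizing sequence stay in \<open>S\<close>, so their squared distance
  from \<open>u\<close> is at least the infimum \<open>D\<close>; the parallelogram law then makes
  the sequence Cauchy.\<close>

lemma nearest_point_exists:
  assumes "closed_subspace S"
  shows "\<exists>v\<in>S. \<forall>s\<in>S. norm (u - v) \<le> norm (u - s)"
proof -
  have sub: "L2.subspace S" and cl: "closed S"
    using assms by (auto simp: closed_subspace_def)
  have 0: "0 \<in> S" using sub by (rule L2.subspace_0)
  define D where "D = Inf ((\<lambda>s. (norm (u - s))\<^sup>2) ` S)"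
  have bdd: "bdd_below ((\<lambda>s. (norm (u - s))\<^sup>2) ` S)"
    by (rule bdd_belowI[of _ 0]) auto
  have D: "D \<le> (norm (u - s))\<^sup>2" if "s \<in> S" for s
    unfolding D_def using that bdd by (intro cInf_lower) auto
  have "\<exists>s\<in>S. (norm (u - s))\<^sup>2 < D + e" if "e > 0" for e
  proof -
    have "Inf ((\<lambda>s. (norm (u - s))\<^sup>2) ` S) < D + e" using that by (simp add: D_def)
    then show ?thesis using 0 bdd by (subst (asm) cInf_less_iff) auto
  qed
  then have "\<exists>s\<in>S. (norm (u - s))\<^sup>2 < D + inverse (real (Suc n))" for n
    by simp
  then obtain v where v: "\<And>n. v n \<in> S" "\<And>n. (norm (u - v n))\<^sup>2 < D + inverse (real (Suc n))"
    by metis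
  have close: "(norm (v m - v n))\<^sup>2 \<le> 2 * inverse (real (Suc m)) + 2 * inverse (real (Suc n))" for m n
  proof -
    let ?a = "u - v m" and ?b = "u - v n"
    have "(1/2) *\<^sub>R (v m + v n) \<in> S"
      using v(1) sub by (intro subspace_scaleR L2.subspace_add)
    then have "D \<le> (norm (u - (1/2) *\<^sub>R (v m + v n)))\<^sup>2" by (rule D)
    also have "u - (1/2) *\<^sub>R (v m + v n) = (1/2) *\<^sub>R (?a + ?b)"
      by (simp add: scaleR_add_right scaleR_diff_right flip: scaleR_add_left)
    also have "(norm \<dots>)\<^sup>2 = (norm (?a + ?b))\<^sup>2 / 4"
      by (simp add: power_mult_distrib power2_eq_square)
    finally have "4 * D \<le> (norm (?a + ?b))\<^sup>2" by simp
    moreover have "(norm (?a - ?b))\<^sup>2 + (norm (?a + ?b))\<^sup>2 = 2 * (norm ?a)\<^sup>2 + 2 * (norm ?b)\<^sup>2"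
      by (simp add: power2_norm_eq_inner inner_add inner_diff algebra_simps inner_commute)
    moreover have "norm (?a - ?b) = norm (v m - v n)"
      by (simp add: norm_minus_commute)
    ultimately show ?thesis using v(2)[of m] v(2)[of n] by simp
  qed
  have "Cauchy v"
  proof (rule CauchyI)
    fix e :: real assume "e > 0"
    then obtain N where N: "inverse (real (Suc N)) < e\<^sup>2 / 4"
      using reals_Archimedean[of "e\<^sup>2 / 4"] by auto
    have "norm (v m - v n) < e" if "m \<ge> N" "n \<ge> N" for m n
    proof -
      have "inverse (real (Suc m)) \<le> inverse (real (Suc N))" "inverse (real (Suc n)) \<le> inverse (real (Suc N))"
        using that by (auto intro!: le_imp_inverse_le)
      then have "(norm (v m - v n))\<^sup>2 < e\<^sup>2"
        using close[of m n] N by linarith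
      then show "norm (v m - v n) < e" using \<open>e > 0\<close> power2_less_imp_less[of _ e] by simp
    qed
    then show "\<exists>N. \<forall>m\<ge>N. \<forall>n\<ge>N. norm (v m - v n) < e" by blast
  qed
  then obtain p where p: "v \<longlonglongrightarrow> p"
    using L2_torus_Cauchy_convergent by (auto simp: convergent_def)
  have "p \<in> S" using cl v(1) p by (metis closed_sequential_limits)
  moreover have "(norm (u - p))\<^sup>2 \<le> D"
  proof (rule LIMSEQ_le)
    show "(\<lambda>n. (norm (u - v n))\<^sup>2) \<longlonglongrightarrow> (norm (u - p))\<^sup>2" by (intro tendsto_intros p)
    show "(\<lambda>n. D + inverse (real (Suc n))) \<longlonglongrightarrow> D"
      by (rule LIMSEQ_inverse_real_of_nat_add)
    show "\<exists>N. \<forall>n\<ge>N. (norm (u - v n))\<^sup>2 \<le> D + inverse (real (Suc n))"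
      using v(2) less_imp_le by blast
  qed
  ultimately show ?thesis
    using D by (metis norm_ge_zero order_trans power2_le_imp_le)
qed

lemma projection_exists:
  assumes S: "closed_subspace S"
  shows "\<exists>v\<in>S. \<forall>s\<in>S. cinner (u - v) s = 0"
proof -
  have sub: "L2.subspace S" using S by (simp add: closed_subspace_def)
  obtain v where v: "v \<in> S" "\<And>s. s \<in> S \<Longrightarrow> norm (u - v) \<le> norm (u - s)"
    using nearest_point_exists[OF S] by blast
  have "inner (u - v) s = 0" if "s \<in> S" for s
  proof (cases "s = 0")
    case False
    \<comment> \<open>The parameter of the point nearest to \<open>u\<close> on the line through
      \<open>v\<close> in direction \<open>s\<close>.\<close>
    define t where "t = inner (u - v) s / inner s s"
    have "v + t *\<^sub>R s \<in> S" using v(1) that sub by (intro L2.subspace_add subspace_scaleR)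
    then have "norm (u - v) \<le> norm ((u - v) - t *\<^sub>R s)" using v(2) by (simp add: diff_diff_eq)
    then have "(norm (u - v))\<^sup>2 \<le> (norm ((u - v) - t *\<^sub>R s))\<^sup>2" by (intro power_mono) auto
    also have "\<dots> = (norm (u - v))\<^sup>2 - 2 * t * inner (u - v) s + t * t * inner s s"
      unfolding power2_norm_eq_inner inner_diff_left[of "u - v"] inner_diff_right[of _ "u - v"]
      by (simp add: inner_commute algebra_simps)
    also have "\<dots> = (norm (u - v))\<^sup>2 - (inner (u - v) s)\<^sup>2 / inner s s"
      using False by (simp add: t_def power2_eq_square field_simps)
    finally have "(inner (u - v) s)\<^sup>2 / inner s s \<le> 0" by simp
    moreover have "inner s s > 0" using False by simp
    ultimately have "(inner (u - v) s)\<^sup>2 \<le> 0" by (simp add: divide_le_0_iff)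
    then show ?thesis by simp
  qed simp
  then show ?thesis using cinner_zero_all_inner[OF sub, of "u - v"] v(1) by blast
qed

text \<open>Evaluates the definite description in \<open>orth_proj\<close>: two candidates differ by
  an element of \<open>S\<close> that is orthogonal to itself.\<close>

lemma orth_proj_unique:
  assumes "L2.subspace S" "v \<in> S" "\<And>s. s \<in> S \<Longrightarrow> cinner (u - v) s = 0"
  shows "orth_proj S u = v"
  unfolding orth_proj_def
proof (rule the_equality)
  fix v' assume v': "v' \<in> S \<and> (\<forall>s\<in>S. cinner (u - v') s = 0)"
  then have "v - v' \<in> S" using assms by (intro L2.subspace_diff) auto
  then have "cinner (u - v') (v - v') = 0" "cinner (u - v) (v - v') = 0"
    using assms v' by auto
  moreover have "v - v' = (u - v') - (u - v)" by simp
  ultimately have "cinner (v - v') (v - v') = 0"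
    by (metis cinner_diff_left diff_zero)
  then show "v' = v" by (simp add: cinner_self_zero_iff)
qed (use assms in auto)

lemma
  assumes "closed_subspace S"
  shows orth_proj_in: "orth_proj S u \<in> S"
    and orth_proj_perp: "s \<in> S \<Longrightarrow> cinner (u - orth_proj S u) s = 0"
proof -
  obtain v where "v \<in> S" "\<And>s. s \<in> S \<Longrightarrow> cinner (u - v) s = 0"
    using projection_exists[OF assms] by blast
  moreover from this have "orth_proj S u = v"
    using assms by (intro orth_proj_unique) (auto simp: closed_subspace_def)
  ultimately show "orth_proj S u \<in> S" "s \<in> S \<Longrightarrow> cinner (u - orth_proj S u) s = 0" by auto
qed

lemma orth_proj_id: "L2.subspace S \<Longrightarrow> u \<in> S \<Longrightarrow> orth_proj S u = u"
  by (rule orth_proj_unique) auto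

lemma orth_proj_add:
  assumes "closed_subspace S"
  shows "orth_proj S (u + v) = orth_proj S u + orth_proj S v"
proof (rule orth_proj_unique)
  have sub: "L2.subspace S" using assms by (simp add: closed_subspace_def)
  then show "L2.subspace S" "orth_proj S u + orth_proj S v \<in> S"
    by (auto intro: L2.subspace_add orth_proj_in[OF assms])
  fix s assume "s \<in> S"
  have "u + v - (orth_proj S u + orth_proj S v) = (u - orth_proj S u) + (v - orth_proj S v)"
    by simp
  then show "cinner (u + v - (orth_proj S u + orth_proj S v)) s = 0"
    using orth_proj_perp[OF assms \<open>s \<in> S\<close>] by (simp only: cinner_add_left) simp
qed

lemma orth_proj_scaleC:
  assumes "closed_subspace S"
  shows "orth_proj S (c *\<^sub>C u) = c *\<^sub>C orth_proj S u"
proof (rule orth_proj_unique)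
  have sub: "L2.subspace S" using assms by (simp add: closed_subspace_def)
  then show "L2.subspace S" "c *\<^sub>C orth_proj S u \<in> S"
    by (auto intro: L2.subspace_scale orth_proj_in[OF assms])
  fix s assume "s \<in> S"
  show "cinner (c *\<^sub>C u - c *\<^sub>C orth_proj S u) s = 0"
    using orth_proj_perp[OF assms \<open>s \<in> S\<close>, of u]
    by (simp add: cinner_scaleC_left flip: L2.scale_right_diff_distrib)
qed

lemma norm_orth_proj_le:
  assumes "closed_subspace S"
  shows "norm (orth_proj S u) \<le> norm u"
proof -
  have "cinner (u - orth_proj S u) (orth_proj S u) = 0"
    by (intro orth_proj_perp orth_proj_in assms)
  then have "cinner u (orth_proj S u) = of_real ((norm (orth_proj S u))\<^sup>2)"
    by (simp add: cinner_diff_left cinner_self_norm)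
  then have "(norm (orth_proj S u))\<^sup>2 \<le> norm u * norm (orth_proj S u)"
    using cmod_cinner_le[of u "orth_proj S u"] by (simp add: norm_power)
  then show ?thesis
    by (cases "orth_proj S u = 0") (auto simp: power2_eq_square)
qed

lemma continuous_on_orth_proj: "closed_subspace S \<Longrightarrow> continuous_on A (orth_proj S)"
proof (intro linear_continuous_on bounded_linear_intro[where K = 1])
  show "closed_subspace S \<Longrightarrow> orth_proj S (r *\<^sub>R u) = r *\<^sub>R orth_proj S u" for r u
    by (simp add: scaleR_L2_torus_def orth_proj_scaleC)
qed (auto simp: orth_proj_add norm_orth_proj_le)

lemma cinner_orth_proj:
  assumes "closed_subspace S"
  shows "cinner (orth_proj S u) v = cinner u (orth_proj S v)"
proof -
  have "cinner (u - orth_proj S u) (orth_proj S v) = 0"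
    by (intro orth_proj_perp orth_proj_in assms)
  moreover have "cinner (v - orth_proj S v) (orth_proj S u) = 0"
    by (intro orth_proj_perp orth_proj_in assms)
  ultimately show ?thesis
    by (metis cinner_commute cinner_diff_left eq_iff_diff_eq_0)
qed

text \<open>For closed subspaces this says that the orthogonal projections onto them commute
  (\<open>reduces_sym\<close>, \<open>orth_proj_commute\<close>); unlike commutation it passes to closures
  of unions in an obvious way.\<close>

definition reduces :: "L2_torus set \<Rightarrow> L2_torus set \<Rightarrow> bool" where
  "reduces S T \<longleftrightarrow> orth_proj S ` T \<subseteq> T"

lemma reducesD: "reduces S T \<Longrightarrow> t \<in> T \<Longrightarrow> orth_proj S t \<in> T"
  by (auto simp: reduces_def)

text \<open>The projection is self-adjoint, so with \<open>T\<close> it also preserves the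
  orthogonal complement of \<open>T\<close>.\<close>

lemma orth_proj_preserves_perp:
  assumes "closed_subspace S" "reduces S T" "\<And>t. t \<in> T \<Longrightarrow> cinner u t = 0" "t \<in> T"
  shows "cinner (orth_proj S u) t = 0"
  using assms by (simp add: cinner_orth_proj reducesD)

text \<open>The total error is the sum of the errors of the two projections, each orthogonal to the
  intersection. The right-hand side is symmetric in \<open>S\<close> and \<open>T\<close>, whence
  commutation.\<close>

lemma orth_proj_compose:
  assumes S: "closed_subspace S" and T: "closed_subspace T" and "reduces S T"
  shows "orth_proj S (orth_proj T u) = orth_proj (S \<inter> T) u"
proof (rule orth_proj_unique[symmetric])
  have "L2.subspace S" "L2.subspace T" using S T by (auto simp: closed_subspace_def)
  then show "L2.subspace (S \<inter> T)" by (rule L2.subspace_inter)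
  show "orth_proj S (orth_proj T u) \<in> S \<inter> T"
    using assms by (auto intro: reducesD orth_proj_in)
  fix s assume s: "s \<in> S \<inter> T"
  have "cinner (u - orth_proj T u) s = 0" "cinner (orth_proj T u - orth_proj S (orth_proj T u)) s = 0"
    using s by (auto intro!: orth_proj_perp S T)
  then show "cinner (u - orth_proj S (orth_proj T u)) s = 0"
    by (simp add: cinner_diff_left)
qed

lemma reduces_nested: "S \<subseteq> T \<Longrightarrow> closed_subspace S \<Longrightarrow> reduces S T"
  by (auto simp: reduces_def dest: orth_proj_in)

text \<open>Split \<open>s\<close> into its projection onto \<open>T\<close> and a remainder
  orthogonal to \<open>T\<close>. The projection onto \<open>S\<close> fixes \<open>s\<close> and
  preserves both \<open>T\<close> and its complement, so it fixes each part; hence the part in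
  \<open>T\<close> lies in \<open>S\<close>.\<close>

lemma reduces_sym:
  assumes S: "closed_subspace S" and T: "closed_subspace T" and "reduces S T"
  shows "reduces T S"
  unfolding reduces_def
proof safe
  fix s assume s: "s \<in> S"
  define r where "r = s - orth_proj T s"
  have "cinner r t = 0" if "t \<in> T" for t
    using that by (simp add: r_def orth_proj_perp[OF T])
  then have "cinner (orth_proj S r) t = 0" if "t \<in> T" for t
    using orth_proj_preserves_perp[OF S \<open>reduces S T\<close>] that by blast
  moreover have "s - orth_proj S (orth_proj T s) = orth_proj S r"
  proof -
    have "orth_proj S s = orth_proj S (orth_proj T s + r)" by (simp add: r_def)
    also have "\<dots> = orth_proj S (orth_proj T s) + orth_proj S r" by (rule orth_proj_add[OF S])
    also have "orth_proj S s = s" using S s by (intro orth_proj_id) (auto simp: closed_subspace_def)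
    finally show ?thesis by (metis add_diff_cancel_left')
  qed
  moreover have "orth_proj S (orth_proj T s) \<in> T"
    using \<open>reduces S T\<close> T by (auto intro: reducesD orth_proj_in)
  ultimately have "orth_proj T s = orth_proj S (orth_proj T s)"
    using T by (intro orth_proj_unique) (auto simp: closed_subspace_def)
  also have "\<dots> \<in> S" by (rule orth_proj_in[OF S])
  finally show "orth_proj T s \<in> S" .
qed

lemma orth_proj_commute:
  assumes S: "closed_subspace S" and T: "closed_subspace T" and "reduces S T"
  shows "orth_proj S (orth_proj T u) = orth_proj T (orth_proj S u)"
  using orth_proj_compose[OF assms] orth_proj_compose[OF T S reduces_sym[OF assms]]
  by (simp add: Int_commute)

lemma reduces_closure_Union:
  assumes S: "closed_subspace S" and "\<And>n. reduces S (T n)"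
  shows "reduces S (closure (\<Union>n. T n))"
proof -
  have "orth_proj S ` closure (\<Union>n. T n) \<subseteq> closure (\<Union>n. T n)"
  proof (rule image_closure_subset)
    show "orth_proj S ` (\<Union>n. T n) \<subseteq> closure (\<Union>n. T n)"
      using assms(2) closure_subset by (fastforce simp: reduces_def)
  qed (auto intro: continuous_on_orth_proj S)
  then show ?thesis by (simp add: reduces_def)
qed

section \<open>Closures and closed spans\<close>

lemma subspace_closure:
  assumes "L2.subspace S"
  shows "L2.subspace (closure S)"
proof (rule L2.subspaceI)
  show "0 \<in> closure S"
    using L2.subspace_0[OF assms] closure_subset by blast
  fix u v assume "u \<in> closure S" "v \<in> closure S"
  then obtain X Y where "\<And>n. X n \<in> S" "X \<longlonglongrightarrow> u" "\<And>n. Y n \<in> S" "Y \<longlonglongrightarrow> v"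
    unfolding closure_sequential by blast
  then show "u + v \<in> closure S"
    unfolding closure_sequential using L2.subspace_add[OF assms]
    by (intro exI[of _ "\<lambda>n. X n + Y n"]) (auto intro: tendsto_add)
next
  fix c u assume "u \<in> closure S"
  have "bounded_linear (\<lambda>u. c *\<^sub>C u)"
    by (rule bounded_linear_intro[where K = "cmod c"])
      (simp_all add: L2.scale_right_distrib scaleR_L2_torus_def norm_scaleC mult.commute)
  then have "(\<lambda>u. c *\<^sub>C u) ` closure S \<subseteq> closure S"
    using L2.subspace_scale[OF assms] closure_subset
    by (intro image_closure_subset linear_continuous_on) auto
  then show "c *\<^sub>C u \<in> closure S" using \<open>u \<in> closure S\<close> by blast
qed

lemma closed_subspace_closed_span: "closed_subspace (closed_span X)"
  by (simp add: closed_subspace_def closed_span_def subspace_closure)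

lemma closed_span_superset: "X \<subseteq> closed_span X"
  unfolding closed_span_def using L2.span_superset closure_subset by blast

lemma closed_span_minimal: "closed_subspace S \<Longrightarrow> X \<subseteq> S \<Longrightarrow> closed_span X \<subseteq> S"
  unfolding closed_span_def closed_subspace_def by (intro closure_minimal L2.span_minimal) auto

lemma closed_subspace_cinner_zero: "closed_subspace {u. cinner u v = 0}"
proof -
  have "closed {u. cinner u v = 0}"
    using continuous_closed_vimage[of "{0}" "\<lambda>u. cinner u v"] continuous_on_cinner_left[of UNIV v]
    by (simp add: vimage_def continuous_on_eq_continuous_at)
  then show ?thesis
    by (auto simp: closed_subspace_def cinner_add_left cinner_scaleC_left intro: L2.subspaceI)
qed

lemma closed_span_perp:
  assumes "\<And>x. x \<in> X \<Longrightarrow> cinner u x = 0" "x \<in> closed_span X"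
  shows "cinner u x = 0"
proof -
  have "closed_span X \<subseteq> {x. cinner x u = 0}"
    using assms(1) by (intro closed_span_minimal closed_subspace_cinner_zero) (auto simp: cinner_eq_zero_sym)
  then show ?thesis using assms(2) by (auto simp: cinner_eq_zero_sym)
qed


section \<open>Multiplication by unimodular functions\<close>

text \<open>No analyticity as in \<open>inner_function\<close>: monomials with negative exponents
  and conjugates are included, and these multipliers are invertible isometries of all of L2.\<close>

definition unimodular :: "L2_torus \<Rightarrow> bool" where
  "unimodular u \<longleftrightarrow> (AE x in torus. cmod (rep_L2_torus u x) = 1)"

lemma unimodular_ess_bounded:
  assumes "unimodular u"
  shows "ess_bounded u"
proof -
  have "AE x in torus. cmod (rep_L2_torus u x) \<le> 1"
    using assms unfolding unimodular_def by eventually_elim simp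
  then show ?thesis by (auto simp: ess_bounded_def)
qed

lemma rep_monomial_torus: "AE x in torus. rep_L2_torus (monomial i j) x = torus_monomial i j x"
  using rep_monomial[of i j] by (simp add: torus_monomial_def)

lemma unimodular_monomial: "unimodular (monomial i j)"
  unfolding unimodular_def using rep_monomial_torus[of i j] AE_space
  by eventually_elim (simp add: norm_torus_monomial)

lemma rep_mult:
  "unimodular u \<Longrightarrow> AE x in torus. rep_L2_torus (L2_mult u f) x = rep_L2_torus u x * rep_L2_torus f x"
  by (intro rep_L2_mult unimodular_ess_bounded)

lemma L2_mult_add:
  assumes "unimodular u"
  shows "L2_mult u (f + g) = L2_mult u f + L2_mult u g"
  by (rule L2_torus_eqI,
    (use rep_mult[OF assms, of "f + g"] rep_mult[OF assms, of f] rep_mult[OF assms, of g]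
      rep_add[of f g] rep_add[of "L2_mult u f" "L2_mult u g"] in eventually_elim),
    simp add: distrib_left)

lemma L2_mult_scaleC:
  assumes "unimodular u"
  shows "L2_mult u (c *\<^sub>C f) = c *\<^sub>C L2_mult u f"
  by (rule L2_torus_eqI,
    (use rep_mult[OF assms, of "c *\<^sub>C f"] rep_mult[OF assms, of f] rep_scaleC[of c f]
      rep_scaleC[of c "L2_mult u f"] in eventually_elim),
    simp)

lemma L2_mult_diff:
  assumes "unimodular u"
  shows "L2_mult u (f - g) = L2_mult u f - L2_mult u g"
  using L2_mult_add[OF assms, of "f - g" g] by simp

lemma cinner_cong_AE:
  assumes "AE x in torus. rep_L2_torus f x * cnj (rep_L2_torus g x) =
     rep_L2_torus f' x * cnj (rep_L2_torus g' x)"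
  shows "cinner f g = cinner f' g'"
  unfolding cinner.rep_eq using assms by (intro integral_cong_AE) auto

lemma cinner_L2_mult:
  assumes "unimodular u"
  shows "cinner (L2_mult u f) (L2_mult u g) = cinner f g"
proof (rule cinner_cong_AE)
  show "AE x in torus. rep_L2_torus (L2_mult u f) x * cnj (rep_L2_torus (L2_mult u g) x) =
     rep_L2_torus f x * cnj (rep_L2_torus g x)"
    using rep_mult[OF assms, of f] rep_mult[OF assms, of g] assms[unfolded unimodular_def]
  proof eventually_elim
    case (elim x)
    then have "rep_L2_torus u x * cnj (rep_L2_torus u x) = 1"
      by (simp flip: complex_norm_square)
    then show ?case using elim(1,2)
      by (simp add: mult_ac)
  qed
qed

lemma norm_L2_mult: "unimodular u \<Longrightarrow> norm (L2_mult u f) = norm f"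
  by (simp add: norm_L2_torus_def inner_L2_torus_def cinner_L2_mult)

lemma bounded_linear_L2_mult: "unimodular u \<Longrightarrow> bounded_linear (L2_mult u)"
  by (rule bounded_linear_intro[where K = 1])
    (simp_all add: L2_mult_add norm_L2_mult scaleR_L2_torus_def L2_mult_scaleC)

lemma L2_mult_commute:
  assumes "unimodular u" "unimodular v"
  shows "L2_mult u (L2_mult v f) = L2_mult v (L2_mult u f)"
  by (rule L2_torus_eqI,
    (use rep_mult[OF assms(1), of "L2_mult v f"] rep_mult[OF assms(2), of f]
      rep_mult[OF assms(2), of "L2_mult u f"] rep_mult[OF assms(1), of f] in eventually_elim),
    simp)

definition L2_cnj :: "L2_torus \<Rightarrow> L2_torus" where
  "L2_cnj u = abs_L2_torus (\<lambda>x. cnj (rep_L2_torus u x))"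

lemma rep_cnj: "AE x in torus. rep_L2_torus (L2_cnj u) x = cnj (rep_L2_torus u x)"
  unfolding L2_cnj_def using square_integrable_rep[of u]
  by (intro rep_abs_L2) (simp add: square_integrable_def)

lemma unimodular_cnj:
  assumes "unimodular u"
  shows "unimodular (L2_cnj u)"
  using rep_cnj[of u] assms unfolding unimodular_def by eventually_elim simp

lemma L2_mult_cnj:
  assumes "unimodular u"
  shows "L2_mult u (L2_mult (L2_cnj u) f) = f" "L2_mult (L2_cnj u) (L2_mult u f) = f"
proof -
  show "L2_mult u (L2_mult (L2_cnj u) f) = f"
  proof (rule L2_torus_eqI)
    show "AE x in torus. rep_L2_torus (L2_mult u (L2_mult (L2_cnj u) f)) x = rep_L2_torus f x"
      using rep_mult[OF assms, of "L2_mult (L2_cnj u) f"] rep_mult[OF unimodular_cnj[OF assms], of f]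
        rep_cnj[of u] assms[unfolded unimodular_def]
    proof eventually_elim
      case (elim x)
      then have "rep_L2_torus u x * cnj (rep_L2_torus u x) = 1"
        by (simp flip: complex_norm_square)
      then show ?case using elim(1-3) by (simp add: mult.assoc[symmetric])
    qed
  qed
  then show "L2_mult (L2_cnj u) (L2_mult u f) = f"
    by (simp add: L2_mult_commute[OF unimodular_cnj assms] assms)
qed

text \<open>Writing the image as a preimage under the inverse multiplier lets continuity give
  closedness.\<close>

lemma L2_mult_image_eq: "unimodular u \<Longrightarrow> L2_mult u ` S = L2_mult (L2_cnj u) -` S"
  by (force simp: L2_mult_cnj image_iff)

lemma closed_subspace_vimage:
  assumes "bounded_linear F" "\<And>c f. F (c *\<^sub>C f) = c *\<^sub>C F f" "closed_subspace S"
  shows "closed_subspace (F -` S)"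
proof -
  interpret bounded_linear F by fact
  have "closed (F -` S)"
    using assms by (intro continuous_closed_vimage linear_continuous_at) (auto simp: closed_subspace_def)
  moreover have "L2.subspace (F -` S)"
    using assms by (intro L2.subspaceI)
      (auto simp: zero add closed_subspace_def intro: L2.subspace_0 L2.subspace_add L2.subspace_scale)
  ultimately show ?thesis by (simp add: closed_subspace_def)
qed

lemma closed_subspace_L2_mult_vimage:
  "unimodular u \<Longrightarrow> closed_subspace S \<Longrightarrow> closed_subspace (L2_mult u -` S)"
  by (intro closed_subspace_vimage bounded_linear_L2_mult L2_mult_scaleC)

lemma closed_subspace_L2_mult_image:
  "unimodular u \<Longrightarrow> closed_subspace S \<Longrightarrow> closed_subspace (L2_mult u ` S)"
  by (simp add: L2_mult_image_eq closed_subspace_L2_mult_vimage unimodular_cnj)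

text \<open>A unitary carries the projection onto \<open>S\<close> to the projection onto the image
  of \<open>S\<close>.\<close>

lemma reduces_L2_mult_image:
  assumes u: "unimodular u" and S: "closed_subspace S" and "reduces S T"
  shows "reduces (L2_mult u ` S) (L2_mult u ` T)"
  unfolding reduces_def
proof safe
  fix t assume "t \<in> T"
  have "orth_proj (L2_mult u ` S) (L2_mult u t) = L2_mult u (orth_proj S t)"
  proof (rule orth_proj_unique)
    show "L2.subspace (L2_mult u ` S)"
      using closed_subspace_L2_mult_image[OF u S] by (simp add: closed_subspace_def)
    show "L2_mult u (orth_proj S t) \<in> L2_mult u ` S"
      by (intro imageI orth_proj_in S)
    fix s assume "s \<in> L2_mult u ` S"
    then obtain s' where "s' \<in> S" "s = L2_mult u s'" by auto
    then show "cinner (L2_mult u t - L2_mult u (orth_proj S t)) s = 0"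
      using orth_proj_perp[OF S] by (simp add: cinner_L2_mult u flip: L2_mult_diff)
  qed
  also have "\<dots> \<in> L2_mult u ` T"
    using assms(3) \<open>t \<in> T\<close> by (intro imageI reducesD)
  finally show "orth_proj (L2_mult u ` S) (L2_mult u t) \<in> L2_mult u ` T" .
qed

section \<open>Shifts by integer exponents and Fourier coefficients in L2\<close>

text \<open>Exponents of either sign are allowed, so the shifts form a group of unitaries on L2 that
  contains the powers of \<open>T_w\<close> and \<open>T_z\<close>.\<close>

definition bishift :: "int \<Rightarrow> int \<Rightarrow> L2_torus \<Rightarrow> L2_torus" where
  "bishift i j = L2_mult (monomial i j)"

lemma rep_shift: "AE x in torus. rep_L2_torus (bishift i j f) x = torus_monomial i j x * rep_L2_torus f x"
  unfolding bishift_def using rep_mult[OF unimodular_monomial, of i j f] rep_monomial_torus[of i j]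
  by eventually_elim simp

lemma shift_shift: "bishift i j (bishift k l f) = bishift (i + k) (j + l) f"
  by (rule L2_torus_eqI,
    (use rep_shift[of i j "bishift k l f"] rep_shift[of k l f]
      rep_shift[of "i + k" "j + l" f] AE_space in eventually_elim),
    simp add: torus_monomial_mult[symmetric] mult.assoc)

lemma shift_0 [simp]: "bishift 0 0 f = f"
  using rep_shift[of 0 0 f] by (intro L2_torus_eqI) (simp add: torus_monomial_def)

lemma shift_image_shift: "bishift i j ` bishift k l ` S = bishift (i + k) (j + l) ` S"
  by (simp add: image_image shift_shift)

lemma shift_monomial: "bishift i j (monomial k l) = monomial (i + k) (j + l)"
  by (rule L2_torus_eqI,
    (use rep_shift[of i j "monomial k l"] rep_monomial_torus[of k l]
      rep_monomial_torus[of "i + k" "j + l"] AE_space in eventually_elim),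
    simp add: torus_monomial_mult[symmetric])

lemma L2_mult_monomial:
  assumes "unimodular u"
  shows "L2_mult u (monomial i j) = bishift i j u"
  by (rule L2_torus_eqI,
    (use rep_mult[OF assms, of "monomial i j"] rep_shift[of i j u]
      rep_monomial_torus[of i j] in eventually_elim),
    simp)

lemma L2_mult_shift: "unimodular u \<Longrightarrow> L2_mult u (bishift i j f) = bishift i j (L2_mult u f)"
  unfolding bishift_def by (rule L2_mult_commute[OF _ unimodular_monomial])

lemma shift_scaleC: "bishift i j (c *\<^sub>C f) = c *\<^sub>C bishift i j f"
  unfolding bishift_def by (rule L2_mult_scaleC[OF unimodular_monomial])

lemma norm_shift: "norm (bishift i j f) = norm f"
  unfolding bishift_def by (rule norm_L2_mult[OF unimodular_monomial])

lemma bounded_linear_shift: "bounded_linear (bishift i j)"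
  unfolding bishift_def by (rule bounded_linear_L2_mult[OF unimodular_monomial])

lemma closed_subspace_shift: "closed_subspace S \<Longrightarrow> closed_subspace (bishift i j ` S)"
  unfolding bishift_def by (rule closed_subspace_L2_mult_image[OF unimodular_monomial])

lemma reduces_shift:
  "closed_subspace S \<Longrightarrow> reduces S T \<Longrightarrow> reduces (bishift i j ` S) (bishift i j ` T)"
  unfolding bishift_def by (rule reduces_L2_mult_image[OF unimodular_monomial])

lemma cinner_shift: "cinner (bishift i j f) g = cinner f (bishift (- i) (- j) g)"
proof -
  have "cinner (bishift i j f) g = cinner (bishift i j f) (bishift i j (bishift (- i) (- j) g))"
    by (simp add: shift_shift)
  also have "\<dots> = cinner f (bishift (- i) (- j) g)"
    unfolding bishift_def by (rule cinner_L2_mult[OF unimodular_monomial])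
  finally show ?thesis .
qed

lemma T_w_funpow: "T_w ^^ m = bishift (int m) 0"
proof (induction m)
  case (Suc m)
  have "T_w f = bishift 1 0 f" for f by (simp add: T_w_def bishift_def)
  then have "T_w (bishift (int m) 0 f) = bishift (int (Suc m)) 0 f" for f
    by (simp add: shift_shift)
  with Suc show ?case by (simp add: fun_eq_iff)
qed (simp add: fun_eq_iff)

lemma T_z_funpow: "T_z ^^ n = bishift 0 (int n)"
proof (induction n)
  case (Suc n)
  have "T_z f = bishift 0 1 f" for f by (simp add: T_z_def bishift_def)
  then have "T_z (bishift 0 (int n) f) = bishift 0 (int (Suc n)) f" for f
    by (simp add: shift_shift)
  with Suc show ?case by (simp add: fun_eq_iff)
qed (simp add: fun_eq_iff)

lemma cinner_monomial: "cinner (monomial i j) (monomial k l) = (if (i, j) = (k, l) then 1 else 0)"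
proof -
  have "cinner (monomial i j) (monomial k l) = (\<integral>x. torus_monomial (i - k) (j - l) x \<partial>torus)"
    unfolding cinner.rep_eq
  proof (rule integral_cong_AE)
    show "AE x in torus. rep_L2_torus (monomial i j) x * cnj (rep_L2_torus (monomial k l) x) =
        torus_monomial (i - k) (j - l) x"
      using rep_monomial_torus[of i j] rep_monomial_torus[of k l] AE_space
      by eventually_elim (simp add: cnj_torus_monomial torus_monomial_mult)
  qed measurable
  then show ?thesis by (simp add: integral_torus_monomial)
qed

text \<open>Completeness of the monomials: \<open>f\<close> is integrable, being its own product
  with the square-integrable constant 1, so Fourier uniqueness applies.\<close>

lemma cinner_monomial_zero_imp_zero:
  assumes "\<And>i j. cinner f (monomial i j) = 0"
  shows "f = 0"
proof -
  have "integrable torus (rep_L2_torus f)"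
  proof -
    interpret prob_space torus by (rule prob_space_torus)
    have "square_integrable (\<lambda>_. 1)" by (simp add: square_integrable_def)
    from integrable_mult_cnj[OF square_integrable_rep this] show ?thesis by simp
  qed
  moreover have "(\<integral>x. torus_monomial i j x * rep_L2_torus f x \<partial>torus) = cinner f (monomial (- i) (- j))" for i j
    unfolding cinner.rep_eq
  proof (rule integral_cong_AE)
    show "AE x in torus. torus_monomial i j x * rep_L2_torus f x =
        rep_L2_torus f x * cnj (rep_L2_torus (monomial (- i) (- j)) x)"
      using rep_monomial_torus[of "- i" "- j"] AE_space
      by eventually_elim (simp add: cnj_torus_monomial)
  qed measurable
  ultimately have "fourier_null (rep_L2_torus f)"
    using assms by (simp add: fourier_null_def)
  then have "AE x in torus. rep_L2_torus f x = 0" by (rule fourier_null_AE_zero)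
  with rep_zero have "AE x in torus. rep_L2_torus f x = rep_L2_torus 0 x"
    by eventually_elim simp
  then show ?thesis by (rule L2_torus_eqI)
qed

text \<open>The Fourier coefficients of the integrable function \<open>f * cnj g\<close> are the numbers
  \<open>cinner (bishift i j f) g\<close>.\<close>

lemma product_constant:
  assumes "\<And>i j. (i, j) \<noteq> (0, 0) \<Longrightarrow> cinner (bishift i j f) g = 0"
  shows "AE x in torus. rep_L2_torus f x * cnj (rep_L2_torus g x) = cinner f g"
proof -
  interpret prob_space torus by (rule prob_space_torus)
  define h where "h x = rep_L2_torus f x * cnj (rep_L2_torus g x)" for x
  have int: "integrable torus h"
    unfolding h_def by (intro integrable_mult_cnj square_integrable_rep)
  have coeff: "(\<integral>x. torus_monomial i j x * h x \<partial>torus) = cinner (bishift i j f) g" for i j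
    unfolding cinner.rep_eq
  proof (rule integral_cong_AE)
    show "AE x in torus. torus_monomial i j x * h x =
        rep_L2_torus (bishift i j f) x * cnj (rep_L2_torus g x)"
      using rep_shift[of i j f] by eventually_elim (simp add: h_def)
  qed (use int in measurable)
  \<comment> \<open>Subtracting the constant removes the only coefficient that the assumption leaves
    free.\<close>
  have "fourier_null (\<lambda>x. h x - cinner f g)"
    unfolding fourier_null_def
  proof (intro conjI allI)
    show "integrable torus (\<lambda>x. h x - cinner f g)" using int by simp
    fix i j
    have "(\<integral>x. torus_monomial i j x * (h x - cinner f g) \<partial>torus) =
        (\<integral>x. torus_monomial i j x * h x \<partial>torus) - (\<integral>x. torus_monomial i j x * cinner f g \<partial>torus)"
      unfolding right_diff_distrib
      by (intro Bochner_Integration.integral_diff integrable_torus_monomial_mult int) simp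
    also have "\<dots> = cinner (bishift i j f) g - (if i = 0 \<and> j = 0 then 1 else 0) * cinner f g"
      by (simp only: coeff integral_mult_left_zero integral_torus_monomial)
    also have "\<dots> = 0" using assms[of i j] by auto
    finally show "(\<integral>x. torus_monomial i j x * (h x - cinner f g) \<partial>torus) = 0" .
  qed
  from fourier_null_AE_zero[OF this] show ?thesis by (simp add: h_def)
qed

lemma cinner_Hardy_monomial:
  assumes "f \<in> Hardy" "i < 0 \<or> j < 0"
  shows "cinner f (monomial i j) = 0"
proof -
  have "cinner (monomial i j) f = 0"
    using assms unfolding Hardy_def
    by (intro closed_span_perp[of _ "monomial i j" f]) (auto simp: cinner_monomial)
  then show ?thesis by (simp add: cinner_eq_zero_sym)
qed

text \<open>The difference between \<open>f\<close> and its projection onto the Hardy space has only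
  zero coefficients: those with a negative exponent vanish for both terms, the others because the
  difference is orthogonal to the Hardy space.\<close>

lemma Hardy_memI:
  assumes "\<And>i j. i < 0 \<or> j < 0 \<Longrightarrow> cinner f (monomial i j) = 0"
  shows "f \<in> Hardy"
proof -
  have H: "closed_subspace Hardy" unfolding Hardy_def by (rule closed_subspace_closed_span)
  have "cinner (f - orth_proj Hardy f) (monomial i j) = 0" for i j
  proof (cases "i < 0 \<or> j < 0")
    case True
    then show ?thesis
      using assms cinner_Hardy_monomial[OF orth_proj_in[OF H]] by (simp add: cinner_diff_left)
  next
    case False
    then have "monomial i j \<in> Hardy"
      unfolding Hardy_def by (intro subsetD[OF closed_span_superset]) (auto simp: not_less)
    then show ?thesis by (rule orth_proj_perp[OF H])
  qed
  then have "f - orth_proj Hardy f = 0" by (rule cinner_monomial_zero_imp_zero)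
  then show ?thesis using orth_proj_in[OF H, of f] by simp
qed


section \<open>The wandering space of a compatible pair\<close>

text \<open>Finds an index at which \<open>f\<close> leaves the family; otherwise induction would
  keep \<open>f\<close> in all members. Applied to \<open>A\<close> and to \<open>B\<close>.\<close>

lemma chain_exit:
  fixes S :: "int \<Rightarrow> L2_torus set"
  assumes "f \<in> S 0" "f \<noteq> 0" "(\<And>n::nat. f \<in> S (int n)) \<Longrightarrow> f = 0"
  obtains i where "i \<ge> 0" "f \<in> S i" "f \<notin> S (i + 1)"
proof -
  have "\<exists>n::nat. f \<in> S (int n) \<and> f \<notin> S (int (Suc n))"
  proof (rule ccontr)
    assume "\<not> ?thesis"
    then have "f \<in> S (int n)" for n :: nat
      using assms(1) by (induction n) auto
    then show False using assms(2,3) by blast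
  qed
  then obtain n where "f \<in> S (int n)" "f \<notin> S (int (Suc n))" by blast
  then show ?thesis using that[of "int n"] by (simp add: add.commute)
qed

lemma closed_subspace_closure_chain:
  fixes T :: "int \<Rightarrow> L2_torus set"
  assumes sub: "\<And>n. L2.subspace (T n)" and mono: "\<And>m n. m \<le> n \<Longrightarrow> T n \<subseteq> T m"
  shows "closed_subspace (closure (\<Union>n. T n))"
proof -
  have "L2.subspace (\<Union>n. T n)"
  proof (rule L2.subspaceI)
    show "0 \<in> (\<Union>n. T n)" using L2.subspace_0[OF sub] by blast
    fix u v assume "u \<in> (\<Union>n. T n)" "v \<in> (\<Union>n. T n)"
    then obtain m n where "u \<in> T m" "v \<in> T n" by blast
    then have "u \<in> T (min m n)" "v \<in> T (min m n)"
      using mono[of "min m n" m] mono[of "min m n" n] by auto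
    then show "u + v \<in> (\<Union>n. T n)" using L2.subspace_add[OF sub] by blast
  qed (use L2.subspace_scale[OF sub] in blast)
  then show ?thesis by (simp add: closed_subspace_def subspace_closure)
qed

section \<open>Commuting projections onto all shifts of the subspace\<close>

text \<open>Compatibility enters as \<open>reduces_axes\<close>, a form that survives shifts and
  closures; the nonnegative exponents there are extended to all integers below.\<close>

locale shift_compatible =
  fixes M :: "L2_torus set"
  assumes closed_subspace_M: "closed_subspace M"
    and M_Hardy: "M \<subseteq> Hardy"
    and shift_M: "i \<ge> 0 \<Longrightarrow> j \<ge> 0 \<Longrightarrow> f \<in> M \<Longrightarrow> bishift i j f \<in> M"
    and reduces_axes: "m \<ge> 0 \<Longrightarrow> n \<ge> 0 \<Longrightarrow> reduces (bishift m 0 ` M) (bishift 0 n ` M)"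
begin

lemma shift_image_antimono:
  assumes "k \<le> i" "l \<le> j"
  shows "bishift i j ` M \<subseteq> bishift k l ` M"
proof -
  have "bishift i j ` M = bishift k l ` bishift (i - k) (j - l) ` M"
    by (simp add: shift_image_shift)
  also have "\<dots> \<subseteq> bishift k l ` M"
    using assms by (intro image_mono) (auto intro: shift_M)
  finally show ?thesis .
qed

lemma closed_subspace_shift_M: "closed_subspace (bishift i j ` M)"
  by (rule closed_subspace_shift[OF closed_subspace_M])

text \<open>Factoring out the common corner \<open>bishift k j\<close> leaves one nonnegative power
  of \<open>w\<close> and one of \<open>z\<close>.\<close>

lemma reduces_shift_incomparable:
  assumes "k \<le> i" "j \<le> l"
  shows "reduces (bishift i j ` M) (bishift k l ` M)"
proof -
  have "reduces (bishift k j ` bishift (i - k) 0 ` M) (bishift k j ` bishift 0 (l - j) ` M)"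
    using assms by (intro reduces_shift reduces_axes closed_subspace_shift_M) auto
  then show ?thesis by (simp add: shift_image_shift)
qed

lemma reduces_shifts: "reduces (bishift i j ` M) (bishift k l ` M)"
proof -
  note closed = closed_subspace_shift_M
  consider "k \<le> i" "l \<le> j" | "i \<le> k" "j \<le> l" | "k \<le> i" "j \<le> l" | "i \<le> k" "l \<le> j"
    by linarith
  then show ?thesis
  proof cases
    case 1
    then show ?thesis by (intro reduces_nested shift_image_antimono closed)
  next
    case 2
    then show ?thesis by (rule reduces_sym[OF closed closed reduces_nested[OF shift_image_antimono closed]])
  next
    case 3
    then show ?thesis by (rule reduces_shift_incomparable)
  next
    case 4
    then show ?thesis by (rule reduces_sym[OF closed closed reduces_shift_incomparable])
  qed
qed

section \<open>The half-plane spaces\<close>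

text \<open>Negative \<open>n\<close> are included, so all powers of \<open>z\<close>, of either
  sign, carry \<open>A i\<close> onto itself; likewise \<open>B j\<close> and the powers of
  \<open>w\<close>.\<close>

definition A :: "int \<Rightarrow> L2_torus set" where
  "A i = closure (\<Union>n. bishift i n ` M)"

definition B :: "int \<Rightarrow> L2_torus set" where
  "B j = closure (\<Union>m. bishift m j ` M)"

lemma closed_subspace_A: "closed_subspace (A i)"
  unfolding A_def using closed_subspace_shift_M
  by (intro closed_subspace_closure_chain shift_image_antimono) (auto simp: closed_subspace_def)

lemma closed_subspace_B: "closed_subspace (B j)"
  unfolding B_def using closed_subspace_shift_M
  by (intro closed_subspace_closure_chain shift_image_antimono) (auto simp: closed_subspace_def)

lemma A_antimono: "i \<le> k \<Longrightarrow> A k \<subseteq> A i"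
  unfolding A_def by (intro closure_mono UN_mono shift_image_antimono) auto

lemma B_antimono: "j \<le> l \<Longrightarrow> B l \<subseteq> B j"
  unfolding B_def by (intro closure_mono UN_mono shift_image_antimono) auto

lemma M_subset_A: "M \<subseteq> A 0"
proof -
  have "M = bishift 0 0 ` M" by simp
  also have "\<dots> \<subseteq> (\<Union>n. bishift 0 n ` M)" by (rule UN_upper) simp
  also have "\<dots> \<subseteq> A 0" unfolding A_def by (rule closure_subset)
  finally show ?thesis .
qed

lemma M_subset_B: "M \<subseteq> B 0"
proof -
  have "M = bishift 0 0 ` M" by simp
  also have "\<dots> \<subseteq> (\<Union>n. bishift n 0 ` M)" by (rule UN_upper) simp
  also have "\<dots> \<subseteq> B 0" unfolding B_def by (rule closure_subset)
  finally show ?thesis .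
qed

lemma shift_image_closure_Union:
  "bishift k l ` closure (\<Union>n. bishift (a n) (b n) ` M) \<subseteq>
    closure (\<Union>n. bishift (k + a n) (l + b n) ` M)"
proof (rule image_closure_subset)
  have "bishift k l ` (\<Union>n. bishift (a n) (b n) ` M) = (\<Union>n. bishift (k + a n) (l + b n) ` M)"
    by (simp only: image_UN shift_image_shift)
  then show "bishift k l ` (\<Union>n. bishift (a n) (b n) ` M) \<subseteq> closure (\<Union>n. bishift (k + a n) (l + b n) ` M)"
    by (simp only: closure_subset)
qed (auto intro: linear_continuous_on bounded_linear_shift)

lemma shift_A: "f \<in> A i \<Longrightarrow> bishift k l f \<in> A (k + i)"
proof -
  have "bishift k l ` A i \<subseteq> closure (\<Union>n. bishift (k + i) (l + n) ` M)"
    unfolding A_def by (rule shift_image_closure_Union)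
  also have "\<dots> \<subseteq> A (k + i)"
    unfolding A_def by (intro closure_mono) auto
  finally show "f \<in> A i \<Longrightarrow> bishift k l f \<in> A (k + i)" by blast
qed

lemma shift_B: "f \<in> B j \<Longrightarrow> bishift k l f \<in> B (l + j)"
proof -
  have "bishift k l ` B j \<subseteq> closure (\<Union>m. bishift (k + m) (l + j) ` M)"
    unfolding B_def by (rule shift_image_closure_Union)
  also have "\<dots> \<subseteq> B (l + j)"
    unfolding B_def by (intro closure_mono) auto
  finally show "f \<in> B j \<Longrightarrow> bishift k l f \<in> B (l + j)" by blast
qed

lemma cinner_shift_M_monomial:
  "f \<in> bishift i j ` M \<Longrightarrow> k < i \<or> l < j \<Longrightarrow> cinner f (monomial k l) = 0"
proof -
  assume "f \<in> bishift i j ` M" and kl: "k < i \<or> l < j"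
  then obtain g where g: "g \<in> M" "f = bishift i j g" by blast
  have "cinner g (monomial (- i + k) (- j + l)) = 0"
    using g(1) M_Hardy kl by (intro cinner_Hardy_monomial) auto
  then show ?thesis by (simp add: g(2) cinner_shift shift_monomial)
qed

text \<open>Elements of the Hardy space have no negative exponents, so after the shift no
  \<open>w\<close>-exponent below \<open>i\<close> occurs; orthogonality to a monomial passes to the
  closure.\<close>

lemma A_monomial: "f \<in> A i \<Longrightarrow> k < i \<Longrightarrow> cinner f (monomial k l) = 0"
proof -
  assume "f \<in> A i" "k < i"
  have "A i \<subseteq> {u. cinner u (monomial k l) = 0}"
    unfolding A_def
  proof (rule closure_minimal)
    show "(\<Union>n. bishift i n ` M) \<subseteq> {u. cinner u (monomial k l) = 0}"
      using cinner_shift_M_monomial \<open>k < i\<close> by blast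
    show "closed {u. cinner u (monomial k l) = 0}"
      using closed_subspace_cinner_zero by (simp add: closed_subspace_def)
  qed
  then show ?thesis using \<open>f \<in> A i\<close> by blast
qed

lemma B_monomial: "f \<in> B j \<Longrightarrow> l < j \<Longrightarrow> cinner f (monomial k l) = 0"
proof -
  assume "f \<in> B j" "l < j"
  have "B j \<subseteq> {u. cinner u (monomial k l) = 0}"
    unfolding B_def
  proof (rule closure_minimal)
    show "(\<Union>m. bishift m j ` M) \<subseteq> {u. cinner u (monomial k l) = 0}"
      using cinner_shift_M_monomial \<open>l < j\<close> by blast
    show "closed {u. cinner u (monomial k l) = 0}"
      using closed_subspace_cinner_zero by (simp add: closed_subspace_def)
  qed
  then show ?thesis using \<open>f \<in> B j\<close> by blast
qed

lemma A_Inter_zero: "(\<And>n::nat. f \<in> A (int n)) \<Longrightarrow> f = 0"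
proof (rule cinner_monomial_zero_imp_zero)
  fix k l assume "\<And>n::nat. f \<in> A (int n)"
  \<comment> \<open>\<open>nat\<close> truncates at 0, so this index exceeds \<open>k\<close> for
    negative \<open>k\<close> as well.\<close>
  then show "cinner f (monomial k l) = 0" by (rule A_monomial[of _ "int (nat (k + 1))"]) simp
qed

lemma B_Inter_zero: "(\<And>n::nat. f \<in> B (int n)) \<Longrightarrow> f = 0"
proof (rule cinner_monomial_zero_imp_zero)
  fix k l assume "\<And>n::nat. f \<in> B (int n)"
  then show "cinner f (monomial k l) = 0" by (rule B_monomial[of _ "int (nat (l + 1))"]) simp
qed

lemma A_Int_B_Hardy: "f \<in> A 0 \<Longrightarrow> f \<in> B 0 \<Longrightarrow> f \<in> Hardy"
  by (rule Hardy_memI) (auto intro: A_monomial B_monomial)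

text \<open>\<open>reduces_closure_Union\<close> forms closures in the second argument only, so
  \<open>A i\<close> is built there and moved to the first by symmetry; this frees the second
  argument for \<open>B j\<close>.\<close>

lemma reduces_A_shift: "reduces (A i) (bishift k l ` M)"
proof (rule reduces_sym[OF closed_subspace_shift_M closed_subspace_A])
  show "reduces (bishift k l ` M) (A i)"
    unfolding A_def by (intro reduces_closure_Union closed_subspace_shift_M reduces_shifts)
qed

lemma reduces_A_B: "reduces (A i) (B j)"
  unfolding B_def by (intro reduces_closure_Union closed_subspace_A reduces_A_shift)

lemma reduces_B_A: "reduces (B j) (A i)"
  by (rule reduces_sym[OF closed_subspace_A closed_subspace_B reduces_A_B])

lemma reduces_A_M: "reduces (A i) M"
  using reduces_A_shift[of i 0 0] by simp

lemma reduces_B_M: "reduces (B j) M"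
proof -
  have "reduces (bishift 0 0 ` M) (B j)"
    unfolding B_def by (intro reduces_closure_Union closed_subspace_shift_M reduces_shifts)
  then have "reduces M (B j)" by simp
  then show ?thesis by (rule reduces_sym[OF closed_subspace_M closed_subspace_B])
qed

section \<open>Wandering spaces\<close>

text \<open>Formed without intersecting with \<open>M\<close>, so that shifts of either sign permute
  the family.\<close>

definition W :: "int \<Rightarrow> int \<Rightarrow> L2_torus set" where
  "W i j = {f \<in> A i \<inter> B j. (\<forall>s\<in>A (i + 1). cinner f s = 0) \<and> (\<forall>s\<in>B (j + 1). cinner f s = 0)}"

lemma shift_W: "f \<in> W i j \<Longrightarrow> bishift k l f \<in> W (k + i) (l + j)"
proof -
  assume f: "f \<in> W i j"
  have "cinner (bishift k l f) s = 0" if "s \<in> A (k + i + 1)" for s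
    using f shift_A[OF that, of "- k" "- l"] by (simp add: W_def cinner_shift)
  moreover have "cinner (bishift k l f) s = 0" if "s \<in> B (l + j + 1)" for s
    using f shift_B[OF that, of "- k" "- l"] by (simp add: W_def cinner_shift)
  ultimately show ?thesis
    using f by (auto simp: W_def intro: shift_A shift_B)
qed

text \<open>In a coordinate where the indices differ, the element with the larger index lies in the
  \<open>A\<close> or \<open>B\<close> space to which the other one is orthogonal.\<close>

lemma W_orthogonal:
  assumes f: "f \<in> W i j" and g: "g \<in> W k l" and "(i, j) \<noteq> (k, l)"
  shows "cinner f g = 0"
proof -
  consider "i < k" | "k < i" | "j < l" | "l < j" using assms(3) by force
  then show ?thesis
  proof cases
    case 1
    then have "g \<in> A (i + 1)" using g A_antimono[of "i + 1" k] by (auto simp: W_def)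
    then show ?thesis using f by (simp add: W_def)
  next
    case 2
    then have "f \<in> A (k + 1)" using f A_antimono[of "k + 1" i] by (auto simp: W_def)
    then show ?thesis using g by (subst cinner_eq_zero_sym) (simp add: W_def)
  next
    case 3
    then have "g \<in> B (j + 1)" using g B_antimono[of "j + 1" l] by (auto simp: W_def)
    then show ?thesis using f by (simp add: W_def)
  next
    case 4
    then have "f \<in> B (l + 1)" using f B_antimono[of "l + 1" j] by (auto simp: W_def)
    then show ?thesis using g by (subst cinner_eq_zero_sym) (simp add: W_def)
  qed
qed

text \<open>The orthogonal decomposition of \<open>M\<close> in the form used later: no nonzero
  element of \<open>M\<close> is orthogonal to all pieces \<open>M \<inter> W i j\<close>. From
  \<open>f\<close> the projection onto \<open>A (i + 1)\<close> is removed, then that onto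
  \<open>B (j + 1)\<close>. Both projections preserve \<open>M\<close>, and by commutation the
  second removal keeps what the first achieved.\<close>

lemma M_meets_W:
  assumes f: "f \<in> M" "f \<noteq> 0"
  obtains i j h where "i \<ge> 0" "j \<ge> 0" "h \<in> M" "h \<in> W i j" "cinner f h \<noteq> 0"
proof -
  have sub: "L2.subspace M" "L2.subspace (A i)" "L2.subspace (B i)" for i
    using closed_subspace_M closed_subspace_A closed_subspace_B by (auto simp: closed_subspace_def)
  \<comment> \<open>The search starts at index 0 because \<open>M\<close> lies in
    \<open>A 0\<close>; this is where the nonnegative exponents come from.\<close>
  obtain i where i: "i \<ge> 0" "f \<in> A i" "f \<notin> A (i + 1)"
    using chain_exit[of f A] f M_subset_A A_Inter_zero by blast
  define p where "p = orth_proj (A (i + 1)) f"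
  define g where "g = f - p"
  have p: "p \<in> A (i + 1)" unfolding p_def by (rule orth_proj_in[OF closed_subspace_A])
  have "p \<in> M" unfolding p_def using f(1) by (rule reducesD[OF reduces_A_M])
  then have gM: "g \<in> M" unfolding g_def using f(1) sub by (intro L2.subspace_diff) auto
  have "p \<in> A i" using p A_antimono[of i "i + 1"] by auto
  then have gA: "g \<in> A i" unfolding g_def using i sub by (intro L2.subspace_diff) auto
  have g_perp: "cinner g s = 0" if "s \<in> A (i + 1)" for s
    using that unfolding g_def p_def by (rule orth_proj_perp[OF closed_subspace_A])
  have "g \<noteq> 0" using p i(3) by (auto simp: g_def)
  then obtain j where j: "j \<ge> 0" "g \<in> B j" "g \<notin> B (j + 1)"
    using chain_exit[of g B] gM M_subset_B B_Inter_zero by blast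
  define q where "q = orth_proj (B (j + 1)) g"
  define h where "h = g - q"
  have q: "q \<in> B (j + 1)" unfolding q_def by (rule orth_proj_in[OF closed_subspace_B])
  have "q \<in> M" unfolding q_def using gM by (rule reducesD[OF reduces_B_M])
  then have hM: "h \<in> M" unfolding h_def using gM sub by (intro L2.subspace_diff) auto
  have "q \<in> A i" unfolding q_def using gA by (rule reducesD[OF reduces_B_A])
  then have hA: "h \<in> A i" unfolding h_def using gA sub by (intro L2.subspace_diff) auto
  have "q \<in> B j" using q B_antimono[of j "j + 1"] by auto
  then have hB: "h \<in> B j" unfolding h_def using j sub by (intro L2.subspace_diff) auto
  have h_perp_B: "cinner h s = 0" if "s \<in> B (j + 1)" for s
    using that unfolding h_def q_def by (rule orth_proj_perp[OF closed_subspace_B])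
  \<comment> \<open>The projection onto \<open>B (j + 1)\<close> preserves \<open>A (i + 1)\<close>,
    hence also its orthogonal complement, which contains \<open>g\<close>.\<close>
  have h_perp_A: "cinner h s = 0" if "s \<in> A (i + 1)" for s
  proof -
    have "cinner q s = 0"
      unfolding q_def using g_perp that
      by (intro orth_proj_preserves_perp[OF closed_subspace_B reduces_B_A]) auto
    then show ?thesis using g_perp[OF that] by (simp add: h_def cinner_diff_left)
  qed
  have "h \<in> W i j" using hA hB h_perp_A h_perp_B by (simp add: W_def)
  \<comment> \<open>Both removed parts \<open>p\<close> and \<open>q\<close> are orthogonal to
    \<open>h\<close>.\<close>
  moreover have "cinner f h = cinner h h"
  proof -
    have "cinner p h = 0" "cinner q h = 0"
      using h_perp_A[OF p] h_perp_B[OF q] by (simp_all add: cinner_eq_zero_sym)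
    moreover have "f = h + q + p" by (simp add: h_def g_def)
    ultimately show ?thesis by (simp add: cinner_add_left)
  qed
  moreover have "h \<noteq> 0" using q j(3) by (auto simp: h_def)
  ultimately show ?thesis
    using that[of i j h] i(1) j(1) hM by (simp add: cinner_self_zero_iff)
qed

text \<open>A nontrivial shift moves \<open>f\<close> into a wandering space orthogonal to the one
  that contains \<open>g\<close>.\<close>

lemma W_product_constant:
  assumes "f \<in> W 0 0" "g \<in> W 0 0"
  shows "AE x in torus. rep_L2_torus f x * cnj (rep_L2_torus g x) = cinner f g"
  using W_orthogonal[OF shift_W[OF assms(1)] assms(2)]
  by (intro product_constant) (metis add_0_right)

lemma wandering_function:
  assumes "M \<noteq> {0}"
  obtains \<phi> where "\<phi> \<in> W 0 0" "norm \<phi> = 1"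
proof -
  have "0 \<in> M" using closed_subspace_M by (simp add: closed_subspace_def L2.subspace_0)
  then obtain f where "f \<in> M" "f \<noteq> 0" using assms by blast
  then obtain i j h where h: "h \<in> W i j" "cinner f h \<noteq> 0" by (rule M_meets_W)
  have "h \<noteq> 0" using h(2) by auto
  \<comment> \<open>Shifting back to the origin may leave \<open>M\<close>, but it stays within the
    wandering family.\<close>
  define \<psi> where "\<psi> = bishift (- i) (- j) h"
  have \<psi>: "\<psi> \<in> W 0 0" using shift_W[OF h(1), of "- i" "- j"] by (simp add: \<psi>_def)
  have "norm \<psi> \<noteq> 0" using \<open>h \<noteq> 0\<close> by (simp add: \<psi>_def norm_shift)
  have "of_real (1 / norm \<psi>) *\<^sub>C \<psi> \<in> W 0 0"
    using \<psi> closed_subspace_A closed_subspace_B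
    by (auto simp: W_def cinner_scaleC_left closed_subspace_def L2.subspace_scale)
  moreover have "norm (of_real (1 / norm \<psi>) *\<^sub>C \<psi>) = 1"
    using \<open>norm \<psi> \<noteq> 0\<close> by (simp add: norm_scaleC norm_divide)
  ultimately show ?thesis by (rule that)
qed

section \<open>From the wandering function to the representation\<close>

lemma representation:
  assumes "M \<noteq> {0}"
  shows "\<exists>\<phi> J. inner_function \<phi> \<and> diagram J \<and> J \<subseteq> {0..} \<times> {0..} \<and>
    M = L2_mult \<phi> ` M_diagram J"
proof -
  obtain \<phi> where \<phi>: "\<phi> \<in> W 0 0" "norm \<phi> = 1" using wandering_function[OF assms] .
  \<comment> \<open>The squared modulus of \<open>\<phi>\<close> is constant, and the constant is
    its squared norm 1.\<close>
  have uni: "unimodular \<phi>"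
    unfolding unimodular_def using W_product_constant[OF \<phi>(1) \<phi>(1)]
  proof eventually_elim
    case (elim x)
    then have "of_real ((cmod (rep_L2_torus \<phi> x))\<^sup>2) = (1 :: complex)"
      using \<phi>(2) by (simp add: cinner_self_norm complex_norm_square del: of_real_power)
    then have "(cmod (rep_L2_torus \<phi> x))\<^sup>2 = 1" by (simp only: of_real_eq_1_iff)
    then show ?case
      by (metis norm_ge_zero one_power2 power2_eq_iff_nonneg zero_le_one)
  qed
  \<comment> \<open>After a shift to the origin, the product with \<open>cnj \<phi>\<close> is
    constant; multiplying by the unimodular \<open>\<phi>\<close> shows that \<open>W 0 0\<close> is
    one-dimensional.\<close>
  have multiple: "\<exists>c. h = c *\<^sub>C bishift i j \<phi>" if h: "h \<in> W i j" for h i j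
  proof -
    define g where "g = bishift (- i) (- j) h"
    have g: "g \<in> W 0 0" using shift_W[OF h, of "- i" "- j"] by (simp add: g_def)
    have "g = cinner g \<phi> *\<^sub>C \<phi>"
    proof (rule L2_torus_eqI)
      show "AE x in torus. rep_L2_torus g x = rep_L2_torus (cinner g \<phi> *\<^sub>C \<phi>) x"
        using W_product_constant[OF g \<phi>(1)] rep_scaleC[of "cinner g \<phi>" \<phi>] uni[unfolded unimodular_def]
      proof eventually_elim
        case (elim x)
        then have "cnj (rep_L2_torus \<phi> x) * rep_L2_torus \<phi> x = 1"
          by (simp add: mult.commute flip: complex_norm_square)
        then show ?case using elim(1,2) by (metis mult.assoc mult.right_neutral)
      qed
    qed
    moreover have "h = bishift i j g" by (simp add: g_def shift_shift)
    ultimately show ?thesis by (metis shift_scaleC)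
  qed
  \<comment> \<open>The sign conditions lose nothing, since \<open>M_meets_W\<close> yields
    nonnegative indices only.\<close>
  define J where "J = {(i, j). i \<ge> 0 \<and> j \<ge> 0 \<and> bishift i j \<phi> \<in> M}"
  have "inner_function \<phi>"
    using uni \<phi>(1) A_Int_B_Hardy[of \<phi>] unimodular_ess_bounded[OF uni]
    by (simp add: inner_function_def Hardy_inf_def unimodular_def W_def)
  moreover have "diagram J"
    unfolding diagram_def
  proof clarify
    fix i j m n :: int assume "(i, j) \<in> J" "m \<ge> 0" "n \<ge> 0"
    then show "(i + m, j + n) \<in> J"
      using shift_M[of m n "bishift i j \<phi>"] by (simp add: J_def shift_shift add.commute)
  qed
  moreover have "J \<subseteq> {0..} \<times> {0..}" by (auto simp: J_def)
  moreover have "M = L2_mult \<phi> ` M_diagram J"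
  proof
    have "M_diagram J \<subseteq> L2_mult \<phi> -` M"
      unfolding M_diagram_def
      by (intro closed_span_minimal closed_subspace_L2_mult_vimage uni closed_subspace_M)
        (auto simp: J_def L2_mult_monomial uni)
    then show sub: "L2_mult \<phi> ` M_diagram J \<subseteq> M" by blast
    define S where "S = L2_mult \<phi> ` M_diagram J"
    have S: "closed_subspace S"
      unfolding S_def M_diagram_def
      by (intro closed_subspace_L2_mult_image uni closed_subspace_closed_span)
    show "M \<subseteq> L2_mult \<phi> ` M_diagram J"
    proof
      fix f assume f: "f \<in> M"
      define g where "g = f - orth_proj S f"
      have "orth_proj S f \<in> M" using orth_proj_in[OF S] sub by (auto simp: S_def)
      then have "g \<in> M"
        unfolding g_def using f closed_subspace_M
        by (intro L2.subspace_diff) (auto simp: closed_subspace_def)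
      \<comment> \<open>Otherwise \<open>g\<close> has nonzero inner product with some
        \<open>h\<close> of \<open>M\<close> in a wandering space. Such an \<open>h\<close> is a
        multiple of a shift of \<open>\<phi>\<close> lying in \<open>S\<close>, but \<open>g\<close>
        is orthogonal to \<open>S\<close>.\<close>
      have "g = 0"
      proof (rule ccontr)
        assume "g \<noteq> 0"
        with \<open>g \<in> M\<close> obtain i j h where h: "i \<ge> 0" "j \<ge> 0" "h \<in> M" "h \<in> W i j" "cinner g h \<noteq> 0"
          by (rule M_meets_W)
        obtain c where c: "h = c *\<^sub>C bishift i j \<phi>" using multiple[OF h(4)] by blast
        have "c \<noteq> 0" using h(5) c by auto
        then have "bishift i j \<phi> = (1 / c) *\<^sub>C h" by (simp add: c)
        then have "bishift i j \<phi> \<in> M"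
          using h(3) closed_subspace_M by (simp add: closed_subspace_def L2.subspace_scale)
        then have "(i, j) \<in> J" using h by (simp add: J_def)
        then have "monomial i j \<in> M_diagram J"
          unfolding M_diagram_def by (intro subsetD[OF closed_span_superset]) blast
        then have "bishift i j \<phi> \<in> S"
          unfolding S_def by (simp add: L2_mult_monomial[OF uni, symmetric])
        then have "h \<in> S" using S c by (simp add: closed_subspace_def L2.subspace_scale)
        then show False using h(5) orth_proj_perp[OF S, of h f] by (simp add: g_def)
      qed
      then have "f = orth_proj S f" by (simp add: g_def)
      then show "f \<in> L2_mult \<phi> ` M_diagram J" using orth_proj_in[OF S, of f] by (simp add: S_def)
    qed
  qed
  ultimately show ?thesis by blast
qed

end

section \<open>Spans of monomials and the converse implication\<close>

text \<open>Monomials are orthonormal, so the projection onto a span of monomials either fixes or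
  annihilates each monomial.\<close>

lemma reduces_M_diagram: "reduces (M_diagram J) (M_diagram K)"
proof -
  have cl: "closed_subspace (M_diagram L)" for L
    unfolding M_diagram_def by (rule closed_subspace_closed_span)
  have mem: "monomial i j \<in> M_diagram L" if "(i, j) \<in> L" for i j L
    unfolding M_diagram_def using that by (intro subsetD[OF closed_span_superset]) blast
  have lin: "bounded_linear (orth_proj (M_diagram J))"
    by (rule bounded_linear_intro[where K = 1])
      (simp_all add: cl orth_proj_add norm_orth_proj_le scaleR_L2_torus_def orth_proj_scaleC)
  have "orth_proj (M_diagram J) (monomial i j) \<in> M_diagram K" if "(i, j) \<in> K" for i j
  proof (cases "(i, j) \<in> J")
    case True
    then have "orth_proj (M_diagram J) (monomial i j) = monomial i j"
      using cl[of J] by (intro orth_proj_id mem) (auto simp: closed_subspace_def)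
    then show ?thesis using that by (simp add: mem)
  next
    case False
    have "cinner (monomial i j) s = 0" if "s \<in> M_diagram J" for s
      using that False unfolding M_diagram_def
      by (intro closed_span_perp[of _ "monomial i j" s]) (auto simp: cinner_monomial)
    then have "orth_proj (M_diagram J) (monomial i j) = 0"
      using cl[of J] by (intro orth_proj_unique) (auto simp: closed_subspace_def L2.subspace_0)
    then show ?thesis using cl[of K] by (simp add: closed_subspace_def L2.subspace_0)
  qed
  then have "M_diagram K \<subseteq> orth_proj (M_diagram J) -` M_diagram K"
    unfolding M_diagram_def[of K]
    by (intro closed_span_minimal closed_subspace_vimage lin closed_subspace_closed_span orth_proj_scaleC cl)
      (auto simp: M_diagram_def)
  then show ?thesis by (auto simp: reduces_def)
qed

text \<open>One inclusion is proved for all shifts; for the inverse shift it yields the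
  other.\<close>

lemma shift_M_diagram:
  "bishift m n ` M_diagram J = M_diagram ((\<lambda>(i, j). (m + i, n + j)) ` J)"
proof -
  have sub: "bishift m n ` M_diagram J \<subseteq> M_diagram ((\<lambda>(i, j). (m + i, n + j)) ` J)" for m n J
  proof -
    have "monomial (m + i) (n + j) \<in> M_diagram ((\<lambda>(i, j). (m + i, n + j)) ` J)" if "(i, j) \<in> J" for i j
      unfolding M_diagram_def using that by (intro subsetD[OF closed_span_superset]) force
    then have "M_diagram J \<subseteq> bishift m n -` M_diagram ((\<lambda>(i, j). (m + i, n + j)) ` J)"
      unfolding M_diagram_def[of J]
      by (intro closed_span_minimal closed_subspace_vimage bounded_linear_shift shift_scaleC)
        (auto simp: shift_monomial M_diagram_def closed_subspace_closed_span)
    then show ?thesis by blast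
  qed
  let ?K = "(\<lambda>(i, j). (m + i, n + j)) ` J"
  have "bishift (- m) (- n) ` M_diagram ?K \<subseteq> M_diagram ((\<lambda>(i, j). (- m + i, - n + j)) ` ?K)"
    by (rule sub)
  also have "(\<lambda>(i, j). (- m + i, - n + j)) ` ?K = J"
    by (force simp: image_image case_prod_unfold)
  finally have "bishift m n ` bishift (- m) (- n) ` M_diagram ?K \<subseteq> bishift m n ` M_diagram J"
    by (rule image_mono)
  then show ?thesis using sub[of m n J] by (simp add: shift_image_shift)
qed

text \<open>Multiplication by \<open>\<phi>\<close> commutes with shifts, so all shifts of
  \<open>M\<close> are images of spans of monomials under one and the same unitary.\<close>

lemma compatible_if_representation:
  assumes M: "closed_subspace M" and inv: "T_w ` M \<subseteq> M" "T_z ` M \<subseteq> M"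
    and uni: "unimodular \<phi>" and rep: "M = L2_mult \<phi> ` M_diagram J"
  shows "compatible M T_w T_z"
proof -
  have T: "T_w = bishift 1 0" "T_z = bishift 0 1"
    using T_w_funpow[of 1] T_z_funpow[of 1] by simp_all
  have iso: "isometry_on M (bishift i j)" if "bishift i j ` M \<subseteq> M" for i j
    using that bounded_linear_shift[of i j]
    by (auto simp: isometry_on_def norm_shift shift_scaleC linear_simps)
  have shifts: "bishift i j ` M = L2_mult \<phi> ` M_diagram ((\<lambda>(k, l). (i + k, j + l)) ` J)" for i j
    unfolding rep shift_M_diagram[symmetric] by (simp add: image_image L2_mult_shift[OF uni])
  have "reduces (bishift i j ` M) (bishift k l ` M)" for i j k l
    unfolding shifts using closed_subspace_closed_span
    by (intro reduces_L2_mult_image[OF uni] reduces_M_diagram) (simp add: M_diagram_def)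
  then have "orth_proj (bishift i j ` M) (orth_proj (bishift k l ` M) u) =
      orth_proj (bishift k l ` M) (orth_proj (bishift i j ` M) u)" for i j k l u
    by (intro orth_proj_commute closed_subspace_shift M)
  then show ?thesis
    unfolding compatible_def T_w_funpow T_z_funpow
    using iso inv unfolding T by (simp add: shift_shift)
qed

section \<open>Passage from compatibility to shifted copies of \<open>M\<close>\<close>

text \<open>An element of the second space is fixed by the projection onto it; by commutation,
  projecting it onto the first space gives a value of that same projection.\<close>

lemma compatible_imp_reduces:
  assumes M: "closed_subspace M" and comp: "compatible M T_w T_z" and "T_z ` M \<subseteq> M"
    and "m \<ge> 0" "n \<ge> 0"
  shows "reduces (bishift m 0 ` M) (bishift 0 n ` M)"
  unfolding reduces_def
proof safe
  fix f assume f: "f \<in> M"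
  \<comment> \<open>Compatibility speaks of arguments in \<open>M\<close> only, so the shifted
    \<open>f\<close> has to be placed there.\<close>
  have "(T_z ^^ k) f \<in> M" for k using f assms(3) by (induction k) auto
  then have t: "bishift 0 n f \<in> M"
    using \<open>n \<ge> 0\<close> by (metis T_z_funpow nat_0_le)
  let ?S = "bishift m 0 ` M" and ?T = "bishift 0 n ` M"
  have T: "closed_subspace ?T" by (rule closed_subspace_shift[OF M])
  have "orth_proj ?S (orth_proj ?T u) = orth_proj ?T (orth_proj ?S u)" if "u \<in> M" for u
  proof -
    have "orth_proj ((T_w ^^ nat m) ` M) (orth_proj ((T_z ^^ nat n) ` M) u) =
       orth_proj ((T_z ^^ nat n) ` M) (orth_proj ((T_w ^^ nat m) ` M) u)"
      using comp that unfolding compatible_def by blast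
    then show ?thesis using assms(4,5) by (simp add: T_w_funpow T_z_funpow)
  qed
  from this[OF t] have "orth_proj ?S (orth_proj ?T (bishift 0 n f)) \<in> ?T"
    using orth_proj_in[OF T] by simp
  moreover have "orth_proj ?T (bishift 0 n f) = bishift 0 n f"
    using T f by (intro orth_proj_id) (auto simp: closed_subspace_def)
  ultimately show "orth_proj ?S (bishift 0 n f) \<in> ?T" by simp
qed

theorem theorem3p1:
  fixes M :: "L2_torus set"
  assumes "L2.subspace M" and "closed M" and "M \<subseteq> Hardy" and "M \<noteq> {0}"
    and "T_w ` M \<subseteq> M" and "T_z ` M \<subseteq> M"
  shows "compatible M T_w T_z \<longleftrightarrow>
    (\<exists>\<phi> J. inner_function \<phi> \<and> diagram J \<and> J \<subseteq> {0..} \<times> {0..} \<and>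
       M = L2_mult \<phi> ` M_diagram J)"
proof
  have M: "closed_subspace M" using assms(1,2) by (simp add: closed_subspace_def)
  show "compatible M T_w T_z" if "\<exists>\<phi> J. inner_function \<phi> \<and> diagram J \<and> J \<subseteq> {0..} \<times> {0..} \<and>
       M = L2_mult \<phi> ` M_diagram J"
    using that compatible_if_representation[OF M assms(5,6)]
    by (auto simp: inner_function_def unimodular_def)
  assume comp: "compatible M T_w T_z"
  have "shift_compatible M"
  proof
    fix i j :: int and f assume ij: "i \<ge> 0" "j \<ge> 0" and "f \<in> M"
    have "(T_z ^^ n) f \<in> M" for n using \<open>f \<in> M\<close> assms(6) by (induction n) auto
    then have "(T_w ^^ m) ((T_z ^^ n) f) \<in> M" for m n using assms(5) by (induction m) auto
    from this[of "nat i" "nat j"] show "bishift i j f \<in> M"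
      using ij by (simp add: T_w_funpow T_z_funpow shift_shift)
  qed (use M assms(3) compatible_imp_reduces[OF M comp assms(6)] in auto)
  then show "\<exists>\<phi> J. inner_function \<phi> \<and> diagram J \<and> J \<subseteq> {0..} \<times> {0..} \<and>
       M = L2_mult \<phi> ` M_diagram J"
    using assms(4) by (rule shift_compatible.representation)
qed

end
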